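(* Let $(X,d_X)$ be a metric space with $n$ points. Then: (A) For all integers $k\ge 0$ with $k>\frac n2-1$, $\mathrm{dgm}_k^{\mathrm{VR}}(X)=\emptyset$. (B) If $n$ is even and $k=\frac n2-1$, then $\mathrm{dgm}_k^{\mathrm{VR}}(X)$ consists of the single point $(t_b(X),t_d(X))$ if and only if $t_b(X)<t_d(X)$, and it is empty otherwise.
   Context: For a finite metric space $X$ and $r\ge 0$, the Vietoris-Rips complex $\mathrm{VR}_r(X)$ is the simplicial complex of nonempty subsets $\sigma\subset X$ with $\mathrm{diam}(\sigma)\le r$. Fix a field $\mathbb F$. The persistence module $r\mapsto \widetilde H_k(\mathrm{VR}_r(X);\mathbb F)$ ($r\ge 0$, reduced homology, maps induced by inclusions) decomposes as a finite direct sum of interval modules supported on intervals $[b_\alpha,d_\alpha)$ with $0\le b_\alpha<d_\alpha<\infty$; $\mathrm{dgm}_k^{\mathrm{VR}}(X)$ is the multiset of the points $(b_\alpha,d_\alpha)$. For a finite metric space $X$ with at least two points and $x\in X$, choose distinct $x_1,x_2\in X$ with $d_X(x,x_1)\ge d_X(x,x_2)\ge d_X(x,a)$ for all $a\in X\setminus\{x_1,x_2\}$, and set $t_d(x):=d_X(x,x_1)$, $t_b(x):=d_X(x,x_2)$ (the two largest distances, counted with multiplicity, from $x$ to points of $X$, where $x$ itself is included with distance $0$). Define $t_b(X):=\max_{x\in X}t_b(x)$ and $t_d(X):=\min_{x\in X}t_d(x)$. *)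

theory Defs
  imports "HOL-Analysis.Abstract_Metric_Spaces" "HOL-Combinatorics.Permutations"
    "HOL-Library.Multiset" "HOL-Library.Function_Algebras" "HOL-Library.Set_Algebras"
begin

section \<open>Vector spaces on a carrier and persistence modules\<close>

text \<open>
  The scalars form a type of class \<open>field\<close>. Homology spaces are quotients, hence proper
  subsets of their types, so a vector space is given by a carrier with explicit operations.
\<close>

record ('f, 'v) vspace =
  vcarrier :: "'v set"
  vadd :: "'v \<Rightarrow> 'v \<Rightarrow> 'v"
  vscale :: "'f \<Rightarrow> 'v \<Rightarrow> 'v"

definition linear_iso ::
  "('f::field, 'v) vspace \<Rightarrow> ('f, 'w) vspace \<Rightarrow> ('v \<Rightarrow> 'w) \<Rightarrow> bool" where
  "linear_iso V W h \<longleftrightarrow>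
     bij_betw h (vcarrier V) (vcarrier W) \<and>
     (\<forall>u\<in>vcarrier V. \<forall>v\<in>vcarrier V. h (vadd V u v) = vadd W (h u) (h v)) \<and>
     (\<forall>a. \<forall>v\<in>vcarrier V. h (vscale V a v) = vscale W a (h v))"

text \<open>
  The quotient of a subspace \<open>U\<close> of a function space by a subspace \<open>W \<subseteq> U\<close>; its elements are
  the cosets \<open>u +o W\<close>. Scaling a coset elementwise by \<open>0\<close> would give \<open>{0}\<close> and not \<open>W\<close>, so
  the result is saturated under \<open>W\<close>.
\<close>

definition quotient_space ::
  "('i \<Rightarrow> 'f::field) set \<Rightarrow> ('i \<Rightarrow> 'f) set \<Rightarrow> ('f, ('i \<Rightarrow> 'f) set) vspace" where
  "quotient_space U W =
     \<lparr>vcarrier = (\<lambda>u. u +o W) ` U,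
      vadd = (\<lambda>P Q. P + Q),
      vscale = (\<lambda>a P. \<Union>u\<in>P. (\<lambda>i. a * u i) +o W)\<rparr>"

text \<open>
  A persistence module over \<open>[0, \<infinity>)\<close>: only the spaces and maps at parameters \<open>0 \<le> r \<le> s\<close>
  are meaningful.
\<close>

record ('f, 'v) persistence_module =
  pspace :: "real \<Rightarrow> ('f, 'v) vspace"
  pmap :: "real \<Rightarrow> real \<Rightarrow> 'v \<Rightarrow> 'v"

definition persistence_iso ::
  "('f::field, 'v) persistence_module \<Rightarrow> ('f, 'w) persistence_module \<Rightarrow> bool" where
  "persistence_iso M N \<longleftrightarrow>
     (\<exists>h. (\<forall>r\<ge>0. linear_iso (pspace M r) (pspace N r) (h r)) \<and>
          (\<forall>r s. 0 \<le> r \<longrightarrow> r \<le> s \<longrightarrow>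
             (\<forall>v\<in>vcarrier (pspace M r). h s (pmap M r s v) = pmap N r s (h r v))))"

text \<open>
  The direct sum of the interval modules supported on \<open>[b\<^sub>i, d\<^sub>i)\<close>, where \<open>(b\<^sub>i, d\<^sub>i)\<close> is the
  \<open>i\<close>-th entry of the list. An element at \<open>r\<close> is its family of coordinates, and the
  coordinate \<open>i\<close> can be nonzero only if \<open>r \<in> [b\<^sub>i, d\<^sub>i)\<close>.
\<close>

definition interval_sum ::
  "(real \<times> real) list \<Rightarrow> ('f::field, nat \<Rightarrow> 'f) persistence_module" where
  "interval_sum bars =
     \<lparr>pspace = (\<lambda>r.
        \<lparr>vcarrier =
           {g. \<forall>i. g i \<noteq> 0 \<longrightarrow> i < length bars \<and> r \<in> {fst (bars ! i)..<snd (bars ! i)}},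
         vadd = (\<lambda>g h i. g i + h i),
         vscale = (\<lambda>a g i. a * g i)\<rparr>),
      pmap = (\<lambda>r s g i. if s \<in> {fst (bars ! i)..<snd (bars ! i)} then g i else 0)\<rparr>"

text \<open>
  The multiset of intervals of an interval decomposition with finitely many bounded intervals
  is unique (Krull--Remak--Schmidt--Azumaya), which justifies the description operator.
\<close>

definition persistence_diagram ::
  "('f::field, 'v) persistence_module \<Rightarrow> (real \<times> real) multiset" where
  "persistence_diagram M =
     (THE D. \<exists>bars. D = mset bars \<and>
        (\<forall>(b, d)\<in>set bars. 0 \<le> b \<and> b < d) \<and>
        persistence_iso M (interval_sum bars))"


section \<open>Reduced simplicial homology with field coefficients\<close>

text \<open>
  A simplicial complex is a set \<open>K\<close> of nonempty finite sets. An oriented simplex is written as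
  the list of its vertices, modulo even permutations. A chain with \<open>p\<close> vertices (dimension
  \<open>p - 1\<close>) is an alternating coefficient function on such lists; it stands for the sum of
  \<open>c [v\<^sub>1, \<dots>, v\<^sub>p]\<close> times the oriented simplex \<open>[v\<^sub>1, \<dots>, v\<^sub>p]\<close>, with one orientation chosen
  for each simplex. For \<open>p = 0\<close> the empty list is admitted, which yields the augmentation term
  of reduced homology.
\<close>

definition chain_space :: "'a set set \<Rightarrow> nat \<Rightarrow> ('a list \<Rightarrow> 'f::field) set" where
  "chain_space K p =
     {c. (\<forall>l. c l \<noteq> 0 \<longrightarrow> length l = p \<and> distinct l \<and> (l = [] \<or> set l \<in> K)) \<and>
         (\<forall>l \<pi>. \<pi> permutes {..<length l} \<longrightarrow> c (permute_list \<pi> l) = of_int (sign \<pi>) * c l)}"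

text \<open>
  The usual boundary \<open>\<partial>[v\<^sub>1, \<dots>, v\<^sub>p] = (\<Sum>i. (-1)^(i-1) [v\<^sub>1, \<dots>, v\<^sub>i omitted, \<dots>, v\<^sub>p])\<close>, read off
  coefficientwise: the simplices with the face \<open>w\<close> are those with vertex set
  \<open>insert v (set w)\<close>, and with the orientation \<open>v # w\<close> the face \<open>w\<close> occurs with sign \<open>+1\<close>.
\<close>

definition boundary :: "'a set set \<Rightarrow> ('a list \<Rightarrow> 'f::field) \<Rightarrow> 'a list \<Rightarrow> 'f" where
  "boundary K c = (\<lambda>w. \<Sum>v\<in>\<Union>K. c (v # w))"

definition cycles :: "'a set set \<Rightarrow> nat \<Rightarrow> ('a list \<Rightarrow> 'f::field) set" where
  "cycles K p = {c \<in> chain_space K p. boundary K c = (\<lambda>_. 0)}"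

definition boundaries :: "'a set set \<Rightarrow> nat \<Rightarrow> ('a list \<Rightarrow> 'f::field) set" where
  "boundaries K p = boundary K ` chain_space K (Suc p)"

text \<open>Degree \<open>k\<close> corresponds to \<open>k + 1\<close> vertices.\<close>

definition reduced_homology ::
  "'a set set \<Rightarrow> nat \<Rightarrow> ('f::field, ('a list \<Rightarrow> 'f) set) vspace" where
  "reduced_homology K k = quotient_space (cycles K (k + 1)) (boundaries K (k + 1))"

text \<open>
  The map in homology induced by an inclusion into the complex \<open>L\<close>, sending the class of a
  cycle \<open>u\<close> to the class of \<open>u\<close> in \<open>L\<close>.
\<close>

definition inclusion_map ::
  "'a set set \<Rightarrow> nat \<Rightarrow> ('a list \<Rightarrow> 'f::field) set \<Rightarrow> ('a list \<Rightarrow> 'f) set" where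
  "inclusion_map L k P = (\<Union>u\<in>P. u +o boundaries L (k + 1))"


section \<open>Vietoris--Rips persistence of a finite metric space\<close>

text \<open>
  A metric space is a pair of a carrier \<open>X\<close> and a distance \<open>d\<close> as in the locale
  \<open>Metric_space\<close>; \<open>diam_of d\<close> is the analogue of \<open>diameter\<close> for such spaces.
\<close>

definition diam_of :: "('a \<Rightarrow> 'a \<Rightarrow> real) \<Rightarrow> 'a set \<Rightarrow> real" where
  "diam_of d S = (if S = {} then 0 else SUP (x, y)\<in>S \<times> S. d x y)"

definition VR :: "'a set \<Rightarrow> ('a \<Rightarrow> 'a \<Rightarrow> real) \<Rightarrow> real \<Rightarrow> 'a set set" where
  "VR X d r = {\<sigma>. \<sigma> \<subseteq> X \<and> \<sigma> \<noteq> {} \<and> diam_of d \<sigma> \<le> r}"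

definition VR_persistence ::
  "'a set \<Rightarrow> ('a \<Rightarrow> 'a \<Rightarrow> real) \<Rightarrow> nat \<Rightarrow> ('f::field, ('a list \<Rightarrow> 'f) set) persistence_module" where
  "VR_persistence X d k =
     \<lparr>pspace = (\<lambda>r. reduced_homology (VR X d r) k),
      pmap = (\<lambda>r s. inclusion_map (VR X d s) k)\<rparr>"

text \<open>The first argument fixes the coefficient field.\<close>

definition dgm_VR ::
  "'f::field itself \<Rightarrow> nat \<Rightarrow> 'a set \<Rightarrow> ('a \<Rightarrow> 'a \<Rightarrow> real) \<Rightarrow> (real \<times> real) multiset" where
  "dgm_VR _ k X d =
     persistence_diagram (VR_persistence X d k :: ('f, ('a list \<Rightarrow> 'f) set) persistence_module)"


section \<open>The two largest distances\<close>

definition farthest_pair :: "'a set \<Rightarrow> ('a \<Rightarrow> 'a \<Rightarrow> real) \<Rightarrow> 'a \<Rightarrow> 'a \<times> 'a" where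
  "farthest_pair X d x =
     (SOME (x1, x2). x1 \<in> X \<and> x2 \<in> X \<and> x1 \<noteq> x2 \<and> d x x1 \<ge> d x x2 \<and>
        (\<forall>a\<in>X - {x1, x2}. d x x2 \<ge> d x a))"

definition td_pt :: "'a set \<Rightarrow> ('a \<Rightarrow> 'a \<Rightarrow> real) \<Rightarrow> 'a \<Rightarrow> real" where
  "td_pt X d x = d x (fst (farthest_pair X d x))"

definition tb_pt :: "'a set \<Rightarrow> ('a \<Rightarrow> 'a \<Rightarrow> real) \<Rightarrow> 'a \<Rightarrow> real" where
  "tb_pt X d x = d x (snd (farthest_pair X d x))"

definition tb :: "'a set \<Rightarrow> ('a \<Rightarrow> 'a \<Rightarrow> real) \<Rightarrow> real" where
  "tb X d = Max (tb_pt X d ` X)"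

definition td :: "'a set \<Rightarrow> ('a \<Rightarrow> 'a \<Rightarrow> real) \<Rightarrow> real" where
  "td X d = Min (td_pt X d ` X)"

end

theory Submission
  imports Defs
begin

text \<open>
  The Vietoris--Rips complex at scale \<open>r\<close> is the clique complex of the graph \<open>d x y \<le> r\<close>. In
  a clique complex on at most \<open>2p\<close> vertices, pick a vertex \<open>v\<close>: if it has no non-neighbour, the
  complex is a cone; otherwise its link has at most \<open>2p - 2\<close> vertices, and exactly \<open>2p - 2\<close> only
  if the complex has \<open>2p\<close> vertices and \<open>v\<close> has a single non-neighbour. Induction over links and
  deletions shows that the homology of \<open>(p - 1)\<close>-cycles vanishes, unless there are \<open>2p\<close> vertices
  with a single non-neighbour each. In that case the complex is the boundary of a cross-polytope,
  whose \<open>(p - 1)\<close>-cycles are the multiples of one cycle and whose \<open>p\<close>-chains vanish. A scale \<open>r\<close>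
  gives every point exactly one non-neighbour iff \<open>t\<^sub>b(X) \<le> r < t\<^sub>d(X)\<close>, and the graph is
  constant on this range.
\<close>

section \<open>Alternating functions and cones\<close>

text \<open>Only adjacent swaps are tested, which suits induction on lists. In characteristic 2 this
  does not exclude repeated vertices; \<open>chain_space\<close> does so by
  \<open>distinct\<close>.\<close>

definition alternating :: "('a list \<Rightarrow> 'f::field) \<Rightarrow> bool" where
  "alternating c \<longleftrightarrow> (\<forall>xs x y ys. c (xs @ y # x # ys) = - c (xs @ x # y # ys))"

lemma alternatingD: "alternating c \<Longrightarrow> c (xs @ y # x # ys) = - c (xs @ x # y # ys)"
  unfolding alternating_def by blast

lemma permute_list_adjacent:
  "permute_list (Transposition.transpose (length xs) (Suc (length xs))) (xs @ x # y # ys)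
    = xs @ y # x # ys"
  (is "permute_list ?\<pi> ?l = ?l'")
proof (rule nth_equalityI)
  fix i
  assume "i < length (permute_list ?\<pi> ?l)"
  then have i: "i < length ?l" by simp
  have p: "?\<pi> permutes {..<length ?l}"
    by (rule permutes_swap_id) auto
  show "permute_list ?\<pi> ?l ! i = ?l' ! i"
    unfolding permute_list_nth[OF p i]
    by (auto simp: Transposition.transpose_def nth_append nth_Cons' split: if_splits)
qed simp

text \<open>Adjacent transpositions generate all permutations of the positions and
  \<open>sign\<close> is multiplicative, so the sign rule extends from the former to the
  latter.\<close>

lemma alternating_iff:
  "alternating (c :: 'a list \<Rightarrow> 'f::field) \<longleftrightarrow>
    (\<forall>l \<pi>. \<pi> permutes {..<length l} \<longrightarrow> c (permute_list \<pi> l) = of_int (sign \<pi>) * c l)"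
proof
  assume alt: "alternating c"
  show "\<forall>l \<pi>. \<pi> permutes {..<length l} \<longrightarrow> c (permute_list \<pi> l) = of_int (sign \<pi>) * c l"
  proof (intro allI impI)
    fix l :: "'a list" and \<pi>
    assume perm: "\<pi> permutes {..<length l}"
    define n where "n = length l"
    \<comment> \<open>The rule is required for all lists of length \<open>n\<close>, because for a
      composite it is applied to an already permuted list.\<close>
    define good where
      "good \<pi> \<longleftrightarrow> \<pi> permutes {..<n} \<and>
        (\<forall>l. length l = n \<longrightarrow> c (permute_list \<pi> l) = of_int (sign \<pi>) * c l)" for \<pi>
    have comp: "good (f \<circ> g)" if "good f" "good g" for f g
    proof -
      have f: "f permutes {..<n}" and g: "g permutes {..<n}" using that by (auto simp: good_def)
      have "sign (f \<circ> g) = sign f * sign g"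
        using f g by (intro sign_compose) (auto simp: permutation_permutes)
      moreover have "permute_list (f \<circ> g) m = permute_list g (permute_list f m)"
        if "length m = n" for m :: "'a list"
        using g that by (intro permute_list_compose) simp
      ultimately show ?thesis
        using that permutes_compose[OF g f] by (simp add: good_def)
    qed
    have adj: "good (Transposition.transpose i (Suc i))" if "Suc i < n" for i
      unfolding good_def
    proof (intro conjI allI impI)
      show "Transposition.transpose i (Suc i) permutes {..<n}"
        using that by (intro permutes_swap_id) auto
      fix m :: "'a list"
      assume m: "length m = n"
      define xs x y ys where "xs = take i m" and "x = m ! i" and "y = m ! Suc i"
        and "ys = drop (Suc (Suc i)) m"
      have "m = xs @ x # y # ys"
        using that m by (simp add: xs_def x_def y_def ys_def Cons_nth_drop_Suc)
      moreover have "i = length xs" using that m by (simp add: xs_def)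
      ultimately show "c (permute_list (Transposition.transpose i (Suc i)) m)
          = of_int (sign (Transposition.transpose i (Suc i))) * c m"
        using alternatingD[OF alt, of xs y x ys] by (simp add: permute_list_adjacent sign_swap_id)
    qed
    \<comment> \<open>Induction on the distance of the two positions: conjugation by the adjacent
      swap \<open>?s\<close> moves the upper one up by one.\<close>
    have trans: "good (Transposition.transpose i (Suc (i + k)))" if "Suc (i + k) < n" for i k
      using that
    proof (induction k)
      case 0
      then show ?case using adj by simp
    next
      case (Suc k)
      let ?s = "Transposition.transpose (Suc (i + k)) (Suc (Suc (i + k)))"
      have "Transposition.transpose i (Suc (i + Suc k))
          = ?s \<circ> (Transposition.transpose i (Suc (i + k)) \<circ> ?s)"
        by (auto simp: Transposition.transpose_def fun_eq_iff)
      moreover have "good ?s" using Suc.prems by (intro adj) simp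
      moreover have "good (Transposition.transpose i (Suc (i + k)))" using Suc by simp
      ultimately show ?case using comp by metis
    qed
    have id: "good id"
      by (simp add: good_def permutes_id)
    have "good (Transposition.transpose i j)" if "i < n" "j < n" for i j
    proof -
      consider "i = j" | k where "j = Suc (i + k)" | k where "i = Suc (j + k)"
        by (metis less_iff_Suc_add linorder_neqE_nat)
      then show ?thesis
        by cases (use id trans that in \<open>auto simp: transpose_commute\<close>)
    qed
    note transp = this
    have "good \<pi>"
      using perm[folded n_def] finite_lessThan
    proof (induction rule: permutes_induct)
      case (swap i j \<pi>)
      then show ?case by (intro comp transp) auto
    qed (rule id)
    then show "c (permute_list \<pi> l) = of_int (sign \<pi>) * c l"
      by (simp add: good_def n_def)
  qed
next
  assume *: "\<forall>l \<pi>. \<pi> permutes {..<length l} \<longrightarrow> c (permute_list \<pi> l) = of_int (sign \<pi>) * c l"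
  show "alternating c"
    unfolding alternating_def
  proof (intro allI)
    fix xs ys :: "'a list" and x y
    have "Transposition.transpose (length xs) (Suc (length xs))
        permutes {..<length (xs @ x # y # ys)}"
      by (rule permutes_swap_id) auto
    from *[rule_format, OF this] show "c (xs @ y # x # ys) = - c (xs @ x # y # ys)"
      by (simp only: permute_list_adjacent) (simp add: sign_swap_id)
  qed
qed

lemma alternating_Cons: "alternating c \<Longrightarrow> alternating (\<lambda>w. c (v # w))"
  unfolding alternating_def by (metis append_Cons)

lemma alternating_swap: "alternating c \<Longrightarrow> c (y # x # ys) = - c (x # y # ys)"
  unfolding alternating_def by (metis append_Nil)

lemma alternating_lincomb:
  assumes "alternating c" "alternating e"
  shows "alternating (\<lambda>l. a * c l + b * e l)"
  unfolding alternating_def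
proof (intro allI)
  fix xs x y ys
  show "a * c (xs @ y # x # ys) + b * e (xs @ y # x # ys)
      = - (a * c (xs @ x # y # ys) + b * e (xs @ x # y # ys))"
    unfolding alternatingD[OF assms(1), of xs y x ys] alternatingD[OF assms(2), of xs y x ys]
    by simp
qed

text \<open>
  The join \<open>v * c\<close> with the vertex \<open>v\<close>: moving \<open>v\<close> to the front of the list past \<open>i\<close> vertices
  costs the sign \<open>(-1)^i\<close>.
\<close>

fun vertex_cone :: "'a \<Rightarrow> ('a list \<Rightarrow> 'f::field) \<Rightarrow> 'a list \<Rightarrow> 'f" where
  "vertex_cone v c [] = 0"
| "vertex_cone v c (x # l) = (if x = v then c l else - vertex_cone v (\<lambda>m. c (x # m)) l)"

lemma cone_lincomb:
  "vertex_cone v (\<lambda>m. a * c m + b * e m) l = a * vertex_cone v c l + b * vertex_cone v e l"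
  by (induction l arbitrary: c e) (auto simp: algebra_simps)

lemma cone_zero [simp]: "vertex_cone v (\<lambda>_. 0) l = 0"
  by (induction l) auto

lemma cone_minus: "vertex_cone v (\<lambda>m. - c m) l = - vertex_cone v c l"
  using cone_lincomb[of v "-1" c 0 c l] by simp

lemma cone_sum: "finite A \<Longrightarrow> vertex_cone v (\<lambda>m. \<Sum>u\<in>A. c u m) l = (\<Sum>u\<in>A. vertex_cone v (c u) l)"
proof (induction A rule: finite_induct)
  case (insert u A)
  then show ?case
    using cone_lincomb[of v 1 "c u" 1 "\<lambda>m. \<Sum>u\<in>A. c u m" l] by simp
qed simp

lemma cone_eq_0: "v \<notin> set l \<Longrightarrow> vertex_cone v c l = 0"
  by (induction l arbitrary: c) auto

lemma cone_nonzeroE: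
  assumes "vertex_cone v c l \<noteq> 0"
  obtains xs ys where "l = xs @ v # ys" "v \<notin> set xs" "c (xs @ ys) \<noteq> 0"
proof -
  have "\<exists>xs ys. l = xs @ v # ys \<and> v \<notin> set xs \<and> c (xs @ ys) \<noteq> 0"
    using assms
  proof (induction l arbitrary: c)
    case (Cons x l)
    show ?case
    proof (cases "x = v")
      case True
      then show ?thesis using Cons.prems by (intro exI[of _ "[]"] exI[of _ l]) auto
    next
      case False
      then obtain xs ys where "l = xs @ v # ys" "v \<notin> set xs" "c (x # xs @ ys) \<noteq> 0"
        using Cons.IH[of "\<lambda>m. c (x # m)"] Cons.prems by auto
      then show ?thesis using False by (intro exI[of _ "x # xs"] exI[of _ ys]) auto
    qed
  qed simp
  then show thesis using that by blast
qed

text \<open>Swaps away from \<open>v\<close> are inherited from \<open>c\<close>; a swap of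
  \<open>v\<close> with its neighbour changes by one the number of vertices that \<open>v\<close>
  passes. The vanishing of \<open>c\<close> on lists with \<open>v\<close> settles a swap of two
  copies of \<open>v\<close>.\<close>

lemma alternating_cone:
  assumes "alternating c" and "\<And>l. v \<in> set l \<Longrightarrow> c l = 0"
  shows "alternating (vertex_cone v c)"
  unfolding alternating_def
proof (intro allI)
  fix xs x y ys
  show "vertex_cone v c (xs @ y # x # ys) = - vertex_cone v c (xs @ x # y # ys)"
    using assms
  proof (induction xs arbitrary: c)
    case Nil
    have "(\<lambda>m. c (y # x # m)) = (\<lambda>m. - c (x # y # m))"
      using alternating_swap[OF Nil.prems(1)] by blast
    then show ?case using Nil.prems(2) by (auto simp: cone_minus)
  next
    case (Cons u xs)
    show ?case
    proof (cases "u = v")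
      case True
      then show ?thesis using alternatingD[OF Cons.prems(1), of xs y x ys] by simp
    next
      case False
      then show ?thesis
        using Cons.IH[OF alternating_Cons[OF Cons.prems(1), of u]] Cons.prems(2) by simp
    qed
  qed
qed

text \<open>The sign \<open>(-1)^i\<close> in the cone cancels the one that \<open>z\<close> picks
  up when \<open>v\<close> moves to the front. So the part of \<open>z\<close> through
  \<open>v\<close> is the join of \<open>v\<close> with its slice.\<close>

lemma cone_slice:
  assumes "alternating z" and "v \<in> set l"
  shows "vertex_cone v (\<lambda>w. z (v # w)) l = z l"
  using assms
proof (induction l arbitrary: z)
  case (Cons x l)
  show ?case
  proof (cases "x = v")
    case False
    have "(\<lambda>m. z (v # x # m)) = (\<lambda>m. - z (x # v # m))"
      using alternating_swap[OF Cons.prems(1)] by blast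
    then show ?thesis
      using False Cons.prems Cons.IH[OF alternating_Cons[OF Cons.prems(1), of x]]
      by (simp add: cone_minus)
  qed simp
qed simp


section \<open>Chains, links and deletions\<close>

lemma chain_space_iff:
  "c \<in> chain_space K p \<longleftrightarrow>
    (\<forall>l. c l \<noteq> 0 \<longrightarrow> length l = p \<and> distinct l \<and> (l = [] \<or> set l \<in> K)) \<and> alternating c"
  by (simp add: chain_space_def alternating_iff)

lemma chain_space_zero: "(\<lambda>_. 0) \<in> chain_space K p"
  by (simp add: chain_space_iff alternating_def)

lemma chain_space_lincomb:
  assumes "c \<in> chain_space K p" and "e \<in> chain_space K p"
  shows "(\<lambda>l. a * c l + b * e l) \<in> chain_space K p"
  using assms unfolding chain_space_iff
  by (auto intro!: alternating_lincomb) (metis add.left_neutral mult_zero_right)+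

lemma chain_space_mono: "K \<subseteq> L \<Longrightarrow> chain_space K p \<subseteq> chain_space L p"
  unfolding subset_iff chain_space_iff by blast

lemma boundary_lincomb:
  "boundary K (\<lambda>l. a * c l + b * e l) = (\<lambda>w. a * boundary K c w + b * boundary K e w)"
  by (simp add: boundary_def sum.distrib sum_distrib_left)

text \<open>\<open>K\<close> enters \<open>boundary\<close> only as the range of summation, and
  further vertices of \<open>L\<close> lie on no simplex of \<open>c\<close>. Boundaries in links
  and deletions can thus be computed in the ambient complex.\<close>

lemma boundary_mono:
  assumes "K \<subseteq> L" "finite (\<Union>L)" "c \<in> chain_space K p"
  shows "boundary K c = boundary L c"
proof
  fix w
  have "c (v # w) = 0" if "v \<notin> \<Union>K" for v
    using assms(3) that unfolding chain_space_iff
    by (metis UnionI list.set_intros(1) list.distinct(1))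
  then show "boundary K c w = boundary L c w"
    unfolding boundary_def using assms(1,2) by (intro sum.mono_neutral_left) auto
qed

lemma cycles_mono: "K \<subseteq> L \<Longrightarrow> finite (\<Union>L) \<Longrightarrow> cycles K p \<subseteq> cycles L p"
  using chain_space_mono[of K L p] boundary_mono[of K L] by (fastforce simp: cycles_def)

lemma boundaries_mono: "K \<subseteq> L \<Longrightarrow> finite (\<Union>L) \<Longrightarrow> boundaries K p \<subseteq> boundaries L p"
  using chain_space_mono[of K L "Suc p"] boundary_mono[of K L] by (fastforce simp: boundaries_def)

lemma cycles_zero: "(\<lambda>_. 0) \<in> cycles K p"
  by (simp add: cycles_def chain_space_zero boundary_def)

lemma cycles_lincomb:
  "c \<in> cycles K p \<Longrightarrow> e \<in> cycles K p \<Longrightarrow> (\<lambda>l. a * c l + b * e l) \<in> cycles K p"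
  by (auto simp: cycles_def boundary_lincomb chain_space_lincomb)

lemma boundaries_zero: "(\<lambda>_. 0) \<in> boundaries K p"
  unfolding boundaries_def
  by (rule image_eqI[OF _ chain_space_zero]) (simp add: boundary_def)

lemma boundaries_lincomb:
  "c \<in> boundaries K p \<Longrightarrow> e \<in> boundaries K p \<Longrightarrow> (\<lambda>l. a * c l + b * e l) \<in> boundaries K p"
  unfolding boundaries_def
  by (auto simp: boundary_lincomb[symmetric] intro!: imageI chain_space_lincomb)

text \<open>Removing the apex from \<open>v * c\<close> returns \<open>c\<close>; removing any other
  vertex commutes with the join up to the sign for passing \<open>v\<close>.\<close>

lemma boundary_cone:
  assumes "finite (\<Union>K)" "v \<in> \<Union>K" and "\<And>l. v \<in> set l \<Longrightarrow> c l = 0"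
  shows "boundary K (vertex_cone v c) = (\<lambda>w. c w - vertex_cone v (boundary K c) w)"
proof
  fix w
  have "boundary K (vertex_cone v c) w
      = vertex_cone v c (v # w) + (\<Sum>u\<in>\<Union>K - {v}. vertex_cone v c (u # w))"
    unfolding boundary_def using assms by (intro sum.remove)
  also have "(\<Sum>u\<in>\<Union>K - {v}. vertex_cone v c (u # w))
      = (\<Sum>u\<in>\<Union>K - {v}. - vertex_cone v (\<lambda>m. c (u # m)) w)"
    by (intro sum.cong) auto
  \<comment> \<open>The added summand \<open>u = v\<close> is zero, since \<open>c\<close> vanishes
    on lists that contain \<open>v\<close>.\<close>
  also have "\<dots> = (\<Sum>u\<in>\<Union>K. - vertex_cone v (\<lambda>m. c (u # m)) w)"
    using assms by (intro sum.mono_neutral_left) auto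
  also have "\<dots> = - vertex_cone v (boundary K c) w"
    unfolding boundary_def using assms(1) by (simp add: sum_negf cone_sum)
  finally show "boundary K (vertex_cone v c) w = c w - vertex_cone v (boundary K c) w"
    by simp
qed

section \<open>Splitting chains at a vertex into a link part and a deletion part\<close>

definition simplicial_complex :: "'a set set \<Rightarrow> bool" where
  "simplicial_complex K \<longleftrightarrow> finite (\<Union>K) \<and> (\<forall>\<sigma>\<in>K. \<forall>\<tau>\<subseteq>\<sigma>. \<tau> \<noteq> {} \<longrightarrow> \<tau> \<in> K)"

definition link :: "'a \<Rightarrow> 'a set set \<Rightarrow> 'a set set" where
  "link v K = {\<sigma>\<in>K. v \<notin> \<sigma> \<and> insert v \<sigma> \<in> K}"

definition deletion :: "'a \<Rightarrow> 'a set set \<Rightarrow> 'a set set" where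
  "deletion v K = {\<sigma>\<in>K. v \<notin> \<sigma>}"

lemma link_subset: "link v K \<subseteq> K"
  by (auto simp: link_def)

lemma link_subset_deletion: "link v K \<subseteq> deletion v K"
  by (auto simp: link_def deletion_def)

lemma deletion_subset: "deletion v K \<subseteq> K"
  by (auto simp: deletion_def)

lemma chain_deletion_avoids:
  "c \<in> chain_space (deletion v K) p \<Longrightarrow> v \<in> set l \<Longrightarrow> c l = 0"
  unfolding chain_space_iff deletion_def by fastforce

lemma chain_link_avoids:
  "c \<in> chain_space (link v K) p \<Longrightarrow> v \<in> set l \<Longrightarrow> c l = 0"
  by (rule chain_deletion_avoids[OF subsetD[OF chain_space_mono[OF link_subset_deletion]]])

text \<open>Faces in the link can be joined with \<open>v\<close> by definition. The hypothesis
  \<open>{v} \<in> K\<close> serves the empty face, which chains with \<open>p = 0\<close> always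
  admit.\<close>

lemma cone_in_chain_space:
  assumes "c \<in> chain_space (link v K) p" and "{v} \<in> K"
  shows "vertex_cone v c \<in> chain_space K (Suc p)"
  unfolding chain_space_iff
proof (intro conjI allI impI)
  show "alternating (vertex_cone v c)"
    using assms(1) chain_link_avoids[OF assms(1)]
    by (intro alternating_cone) (auto simp: chain_space_iff)
  fix l
  assume "vertex_cone v c l \<noteq> 0"
  then obtain xs ys where l: "l = xs @ v # ys" and nz: "c (xs @ ys) \<noteq> 0"
    by (rule cone_nonzeroE)
  have v: "v \<notin> set (xs @ ys)" using chain_link_avoids[OF assms(1)] nz by blast
  have *: "length (xs @ ys) = p" "distinct (xs @ ys)" "xs @ ys = [] \<or> set (xs @ ys) \<in> link v K"
    using assms(1) nz unfolding chain_space_iff by blast+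
  show "length l = Suc p" "distinct l" using * v l by auto
  have "set l = insert v (set (xs @ ys))" using l by auto
  then show "l = [] \<or> set l \<in> K"
    using * assms(2) by (auto simp: link_def)
qed

lemma slice_in_chain_space:
  assumes "simplicial_complex K" and "z \<in> chain_space K (Suc p)"
  shows "(\<lambda>w. z (v # w)) \<in> chain_space (link v K) p"
  unfolding chain_space_iff
proof (intro conjI allI impI)
  show "alternating (\<lambda>w. z (v # w))"
    using assms(2) by (simp add: chain_space_iff alternating_Cons)
  fix w
  assume "z (v # w) \<noteq> 0"
  then have *: "length (v # w) = Suc p" "distinct (v # w)" "set (v # w) \<in> K"
    using assms(2) unfolding chain_space_iff by blast+
  then show "length w = p" "distinct w" by auto
  have "set w \<in> K" if "w \<noteq> []"
    using assms(1) *(3) that unfolding simplicial_complex_def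
    by (metis set_empty set_subset_Cons)
  then show "w = [] \<or> set w \<in> link v K"
    using * by (auto simp: link_def)
qed

text \<open>\<open>v\<close> and the summed vertex trade places at the front, which costs one sign.
  Hence slices of cycles are cycles.\<close>

lemma boundary_slice:
  assumes "alternating z"
  shows "boundary K (\<lambda>w. z (v # w)) = (\<lambda>w. - boundary K z (v # w))"
proof
  fix w
  have "(\<Sum>u\<in>\<Union>K. z (v # u # w)) = (\<Sum>u\<in>\<Union>K. - z (u # v # w))"
    using assms by (intro sum.cong refl) (rule alternating_swap)
  then show "boundary K (\<lambda>w. z (v # w)) w = - boundary K z (v # w)"
    by (simp add: boundary_def sum_negf)
qed

text \<open>By \<open>cone_slice\<close> the subtraction cancels every coefficient on a list through
  \<open>v\<close>; on the other lists the cone vanishes and \<open>z\<close> is unchanged.\<close>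

lemma minus_cone_slice_in_chain_space:
  assumes "simplicial_complex K" "{v} \<in> K" "z \<in> chain_space K (Suc p)"
  shows "(\<lambda>l. z l - vertex_cone v (\<lambda>w. z (v # w)) l) \<in> chain_space (deletion v K) (Suc p)"
  unfolding chain_space_iff
proof (intro conjI allI impI)
  have alt: "alternating z" using assms by (simp add: chain_space_iff)
  have "vertex_cone v (\<lambda>w. z (v # w)) \<in> chain_space K (Suc p)"
    using assms by (intro cone_in_chain_space slice_in_chain_space)
  then show "alternating (\<lambda>l. z l - vertex_cone v (\<lambda>w. z (v # w)) l)"
    using alt alternating_lincomb[of z _ 1 "-1"] by (simp add: chain_space_iff)
  fix l
  assume nz: "z l - vertex_cone v (\<lambda>w. z (v # w)) l \<noteq> 0"
  then have v: "v \<notin> set l" using cone_slice[OF alt] by force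
  then have "z l \<noteq> 0" using nz by (simp add: cone_eq_0)
  then show "length l = Suc p" "distinct l" "l = [] \<or> set l \<in> deletion v K"
    using assms(3) v unfolding chain_space_iff deletion_def by blast+
qed

text \<open>As \<open>p\<close> counts vertices, this is the vanishing of reduced homology in degree
  \<open>p - 1\<close>. The type argument fixes the coefficients.\<close>

definition acyclic_at :: "'f::field itself \<Rightarrow> 'a set set \<Rightarrow> nat \<Rightarrow> bool" where
  "acyclic_at _ K p \<longleftrightarrow> (cycles K p :: ('a list \<Rightarrow> 'f) set) \<subseteq> boundaries K p"

lemma cycle_slice:
  assumes "simplicial_complex K" "z \<in> cycles K (Suc p)"
  shows "(\<lambda>w. z (v # w)) \<in> cycles (link v K) p"
proof -
  have ch: "(\<lambda>w. z (v # w)) \<in> chain_space (link v K) p"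
    using assms by (intro slice_in_chain_space) (auto simp: cycles_def)
  have "alternating z" using assms by (simp add: cycles_def chain_space_iff)
  then have "boundary K (\<lambda>w. z (v # w)) = (\<lambda>_. 0)"
    using assms by (simp add: boundary_slice cycles_def)
  moreover have "boundary (link v K) (\<lambda>w. z (v # w)) = boundary K (\<lambda>w. z (v # w))"
    using ch assms(1) by (intro boundary_mono[OF link_subset]) (auto simp: simplicial_complex_def)
  ultimately show ?thesis using ch by (simp add: cycles_def)
qed

text \<open>
  The exactness of \<open>H\<^sub>p(K - v) \<rightarrow> H\<^sub>p(K) \<rightarrow> H\<^sub>p\<^sub>-\<^sub>1(lk v)\<close> in the middle.
\<close>

lemma acyclic_at_link_deletion:
  assumes K: "simplicial_complex K" "{v} \<in> K"
    and lk: "acyclic_at TYPE('f::field) (link v K) p"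
    and del: "acyclic_at TYPE('f) (deletion v K) (Suc p)"
  shows "acyclic_at TYPE('f) K (Suc p)"
  unfolding acyclic_at_def
proof
  fix z :: "_ \<Rightarrow> 'f"
  assume z: "z \<in> cycles K (Suc p)"
  define a where "a = (\<lambda>w. z (v # w))"
  have fin: "finite (\<Union>K)" and vK: "v \<in> \<Union>K" using K by (auto simp: simplicial_complex_def)
  have zch: "z \<in> chain_space K (Suc p)" and zb: "boundary K z = (\<lambda>_. 0)"
    using z by (auto simp: cycles_def)
  have a: "a \<in> cycles (link v K) p" unfolding a_def using K(1) z by (rule cycle_slice)
  have ach: "a \<in> chain_space (link v K) p" using a by (simp add: cycles_def)
  have ab: "boundary K a = (\<lambda>_. 0)"
    using a boundary_mono[OF link_subset fin ach] by (simp add: cycles_def)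
  obtain b where b: "b \<in> chain_space (link v K) (Suc p)" and ba: "boundary (link v K) b = a"
    using a lk unfolding acyclic_at_def boundaries_def by blast
  have bb: "boundary K b = a" using boundary_mono[OF link_subset fin b] ba by simp
  \<comment> \<open>Since \<open>\<partial>(v * b) = b - v * a\<close>, the chain \<open>c\<close>
    is \<open>z + \<partial>(v * b)\<close>: homologous to \<open>z\<close>, but without simplices
    through \<open>v\<close>.\<close>
  define c where "c = (\<lambda>l. z l - vertex_cone v a l + b l)"
  have cch: "c \<in> chain_space (deletion v K) (Suc p)"
    using chain_space_lincomb[OF minus_cone_slice_in_chain_space[OF K zch]
        subsetD[OF chain_space_mono[OF link_subset_deletion] b], of 1 1]
    unfolding c_def a_def by simp
  have "boundary K (vertex_cone v a) = a"
    using boundary_cone[OF fin vK, of a] chain_link_avoids[OF ach] ab by simp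
  moreover have "boundary K c
      = (\<lambda>w. boundary K z w - boundary K (vertex_cone v a) w + boundary K b w)"
    unfolding c_def boundary_def by (simp add: sum.distrib sum_subtractf)
  ultimately have "boundary K c = (\<lambda>_. 0)" using zb bb by simp
  then have "c \<in> cycles (deletion v K) (Suc p)"
    using cch boundary_mono[OF deletion_subset fin cch] by (simp add: cycles_def)
  then obtain e where e: "e \<in> chain_space (deletion v K) (Suc (Suc p))"
    and ec: "boundary (deletion v K) e = c"
    using del unfolding acyclic_at_def boundaries_def by blast
  have eb: "boundary K e = c" using boundary_mono[OF deletion_subset fin e] ec by simp
  \<comment> \<open>The correction is undone: as \<open>\<partial>e = c\<close>, the chain
    \<open>e - v * b\<close> fills \<open>z\<close>.\<close>
  have "boundary K (vertex_cone v b) = (\<lambda>w. b w - vertex_cone v a w)"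
    using boundary_cone[OF fin vK, of b] chain_link_avoids[OF b] bb by simp
  then have "boundary K (\<lambda>l. 1 * e l + (-1) * vertex_cone v b l) = z"
    unfolding boundary_lincomb eb by (simp add: c_def)
  moreover have "(\<lambda>l. 1 * e l + (-1) * vertex_cone v b l) \<in> chain_space K (Suc (Suc p))"
    using subsetD[OF chain_space_mono[OF deletion_subset] e] cone_in_chain_space[OF b K(2)]
    by (rule chain_space_lincomb)
  ultimately show "z \<in> boundaries K (Suc p)" unfolding boundaries_def by (rule image_eqI[OF sym])
qed

text \<open>\<open>K\<close> is a cone with apex \<open>v\<close>, so link and deletion of
  \<open>v\<close> agree and the part \<open>c\<close> of \<open>z\<close> off \<open>v\<close> can
  be coned. Then \<open>\<partial>(v * c) = c - v * \<partial>c = c + v * a = z\<close>.\<close>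

lemma acyclic_at_apex:
  assumes K: "simplicial_complex K" "{v} \<in> K" and apex: "\<And>\<sigma>. \<sigma> \<in> K \<Longrightarrow> insert v \<sigma> \<in> K"
  shows "acyclic_at TYPE('f::field) K (Suc p)"
  unfolding acyclic_at_def
proof
  fix z :: "_ \<Rightarrow> 'f"
  assume z: "z \<in> cycles K (Suc p)"
  define a where "a = (\<lambda>w. z (v # w))"
  define c where "c = (\<lambda>l. z l - vertex_cone v a l)"
  have fin: "finite (\<Union>K)" and vK: "v \<in> \<Union>K" using K by (auto simp: simplicial_complex_def)
  have zch: "z \<in> chain_space K (Suc p)" and zb: "boundary K z = (\<lambda>_. 0)"
    using z by (auto simp: cycles_def)
  have a: "a \<in> cycles (link v K) p" unfolding a_def using K(1) z by (rule cycle_slice)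
  have ach: "a \<in> chain_space (link v K) p" using a by (simp add: cycles_def)
  have ab: "boundary K a = (\<lambda>_. 0)"
    using a boundary_mono[OF link_subset fin ach] by (simp add: cycles_def)
  have "deletion v K = link v K" using apex by (auto simp: link_def deletion_def)
  then have cch: "c \<in> chain_space (link v K) (Suc p)"
    using minus_cone_slice_in_chain_space[OF K zch] unfolding c_def a_def by simp
  have "boundary K (vertex_cone v a) = a"
    using boundary_cone[OF fin vK, of a] chain_link_avoids[OF ach] ab by simp
  moreover have "boundary K c = (\<lambda>w. boundary K z w - boundary K (vertex_cone v a) w)"
    unfolding c_def boundary_def by (simp add: sum_subtractf)
  ultimately have "boundary K c = (\<lambda>w. - a w)" using zb by simp
  then have "boundary K (vertex_cone v c) = z"
    using boundary_cone[OF fin vK, of c] chain_link_avoids[OF cch]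
    by (simp add: cone_minus c_def)
  then show "z \<in> boundaries K (Suc p)"
    unfolding boundaries_def using cone_in_chain_space[OF cch K(2)] by blast
qed


section \<open>Clique complexes\<close>

definition clique_complex :: "'a set \<Rightarrow> ('a \<Rightarrow> 'a \<Rightarrow> bool) \<Rightarrow> 'a set set" where
  "clique_complex V E = {\<sigma>. \<sigma> \<subseteq> V \<and> \<sigma> \<noteq> {} \<and> (\<forall>x\<in>\<sigma>. \<forall>y\<in>\<sigma>. x \<noteq> y \<longrightarrow> E x y)}"

lemma Union_clique_complex [simp]: "\<Union>(clique_complex V E) = V"
proof
  show "V \<subseteq> \<Union>(clique_complex V E)"
  proof
    fix x
    assume "x \<in> V"
    then have "{x} \<in> clique_complex V E" by (simp add: clique_complex_def)
    then show "x \<in> \<Union>(clique_complex V E)" by blast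
  qed
qed (auto simp: clique_complex_def)

lemma simplicial_complex_clique_complex: "finite V \<Longrightarrow> simplicial_complex (clique_complex V E)"
  unfolding simplicial_complex_def Union_clique_complex
  by (auto simp: clique_complex_def subset_iff)

lemma singleton_in_clique_complex: "v \<in> V \<Longrightarrow> {v} \<in> clique_complex V E"
  by (simp add: clique_complex_def)

lemma link_clique_complex:
  "symp E \<Longrightarrow> v \<in> V \<Longrightarrow>
    link v (clique_complex V E) = clique_complex {u\<in>V. u \<noteq> v \<and> E v u} E"
  by (auto simp: link_def clique_complex_def dest: sympD)

lemma deletion_clique_complex:
  "deletion v (clique_complex V E) = clique_complex (V - {v}) E"
  by (auto simp: deletion_def clique_complex_def)

abbreviation non_neighbours :: "'a set \<Rightarrow> ('a \<Rightarrow> 'a \<Rightarrow> bool) \<Rightarrow> 'a \<Rightarrow> 'a set" where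
  "non_neighbours V E v \<equiv> {u\<in>V. u \<noteq> v \<and> \<not> E v u}"

lemma card_neighbours:
  assumes "finite V" "v \<in> V"
  shows "card {u\<in>V. u \<noteq> v \<and> E v u} + card (non_neighbours V E v) + 1 = card V"
proof -
  have "V = insert v ({u\<in>V. u \<noteq> v \<and> E v u} \<union> non_neighbours V E v)" using assms by auto
  then have "card V = card (insert v ({u\<in>V. u \<noteq> v \<and> E v u} \<union> non_neighbours V E v))" by simp
  also have "\<dots> = Suc (card ({u\<in>V. u \<noteq> v \<and> E v u} \<union> non_neighbours V E v))"
    using assms by (intro card_insert_disjoint) auto
  also have "card ({u\<in>V. u \<noteq> v \<and> E v u} \<union> non_neighbours V E v)
      = card {u\<in>V. u \<noteq> v \<and> E v u} + card (non_neighbours V E v)"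
    using assms by (intro card_Un_disjoint) auto
  finally show ?thesis by simp
qed

lemma acyclic_at_dominating:
  assumes "finite V" "symp E" "v \<in> V" "non_neighbours V E v = {}"
  shows "acyclic_at TYPE('f::field) (clique_complex V E) (Suc p)"
proof (rule acyclic_at_apex)
  fix \<sigma>
  assume "\<sigma> \<in> clique_complex V E"
  moreover have "E v u" "E u v" if "u \<in> V" "u \<noteq> v" for u
    using assms that by (auto dest: sympD)
  ultimately show "insert v \<sigma> \<in> clique_complex V E"
    using assms(3) by (auto simp: clique_complex_def)
qed (use assms in \<open>auto simp: simplicial_complex_clique_complex singleton_in_clique_complex\<close>)

text \<open>A non-neighbour of \<open>v\<close> makes the link at least two vertices smaller than
  \<open>V\<close>, which pays for lowering \<open>p\<close> by one; deleting \<open>v\<close> keeps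
  \<open>p\<close> and lowers \<open>card V\<close>. Hence an outer induction on \<open>p\<close>
  for links and an inner one on \<open>card V\<close> for deletions.\<close>

lemma acyclic_at_few_vertices:
  assumes "symp E" "finite V" "card V < 2 * p"
  shows "acyclic_at TYPE('f::field) (clique_complex V E) p"
  using assms(2,3)
proof (induction p arbitrary: V)
  case (Suc p)
  show ?case
    using Suc.prems
  proof (induction "card V" arbitrary: V rule: less_induct)
    case less
    show ?case
    proof (cases "V = {}")
      case True
      \<comment> \<open>Without vertices no nonempty list carries a coefficient, so the zero chain
        is the only cycle.\<close>
      then have "(cycles (clique_complex V E) (Suc p) :: (_ \<Rightarrow> 'f) set) \<subseteq> {\<lambda>_. 0}"
        by (fastforce simp: cycles_def chain_space_iff clique_complex_def)
      then show ?thesis using boundaries_zero unfolding acyclic_at_def by blast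
    next
      case False
      then obtain v where v: "v \<in> V" by blast
      show ?thesis
      proof (cases "non_neighbours V E v = {}")
        case True
        then show ?thesis using less.prems(1) assms(1) v by (intro acyclic_at_dominating)
      next
        case False
        then have "card (non_neighbours V E v) > 0" using less.prems(1) by (simp add: card_gt_0_iff)
        then have "card {u\<in>V. u \<noteq> v \<and> E v u} < 2 * p"
          using card_neighbours[OF less.prems(1) v, of E] less.prems(2) by simp
        then have lk: "acyclic_at TYPE('f) (link v (clique_complex V E)) p"
          using Suc.IH less.prems(1) assms(1) v by (simp add: link_clique_complex)
        have "card (V - {v}) < card V" using v less.prems(1) by (intro card_Diff1_less)
        then have "acyclic_at TYPE('f) (deletion v (clique_complex V E)) (Suc p)"
          using less unfolding deletion_clique_complex by auto
        with lk show ?thesis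
          by (rule acyclic_at_link_deletion[OF simplicial_complex_clique_complex[OF less.prems(1)]
                singleton_in_clique_complex[OF v]])
      qed
    qed
  qed
qed simp

text \<open>
  Every vertex having exactly one non-neighbour characterizes the boundary of a cross-polytope.
\<close>

lemma acyclic_at_not_cross_polytope:
  assumes "symp E" "finite V" "card V = 2 * p" "v \<in> V" "card (non_neighbours V E v) \<noteq> 1"
  shows "acyclic_at TYPE('f::field) (clique_complex V E) p"
proof -
  obtain q where q: "p = Suc q" using assms by (cases p) auto
  show ?thesis
  proof (cases "non_neighbours V E v = {}")
    case True
    then show ?thesis unfolding q using assms by (intro acyclic_at_dominating)
  next
    case False
    \<comment> \<open>Being neither 0 nor 1, the number of non-neighbours is at least 2, so fewer
      than \<open>2 * q\<close> of the \<open>2 * q + 2\<close> vertices lie in the link.\<close>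
    then have "card (non_neighbours V E v) > 0" using assms(2) by (simp add: card_gt_0_iff)
    then have "card {u\<in>V. u \<noteq> v \<and> E v u} < 2 * q"
      using card_neighbours[OF assms(2,4), of E] assms(3,5) q by linarith
    then have "acyclic_at TYPE('f) (link v (clique_complex V E)) q"
      unfolding link_clique_complex[OF assms(1,4)]
      using assms by (intro acyclic_at_few_vertices) auto
    moreover have "acyclic_at TYPE('f) (deletion v (clique_complex V E)) (Suc q)"
      unfolding deletion_clique_complex
      using assms q by (intro acyclic_at_few_vertices) auto
    ultimately show ?thesis
      unfolding q
      by (rule acyclic_at_link_deletion[OF simplicial_complex_clique_complex[OF assms(2)]
            singleton_in_clique_complex[OF assms(4)]])
  qed
qed

text \<open>A clique never contains a vertex together with its only non-neighbour, its antipode. So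
  a clique on \<open>p\<close> vertices is disjoint from the set of its antipodes, and together they
  need \<open>2 * p\<close> vertices.\<close>

lemma cross_polytope_chain_space:
  assumes "symp E" "finite V" "card V < 2 * p" "\<And>v. v \<in> V \<Longrightarrow> card (non_neighbours V E v) = 1"
  shows "chain_space (clique_complex V E) p = {\<lambda>_. 0}"
proof -
  have "c l = 0" if c: "c \<in> chain_space (clique_complex V E) p" for c :: "_ \<Rightarrow> 'b::field" and l
  proof (rule ccontr)
    assume "c l \<noteq> 0"
    then have l: "length l = p" "distinct l" "set l \<in> clique_complex V E"
      using c assms(3) unfolding chain_space_iff by fastforce+
    define \<sigma> where "\<sigma> = set l"
    have \<sigma>: "\<sigma> \<subseteq> V" "card \<sigma> = p" "finite \<sigma>" "\<And>x y. x \<in> \<sigma> \<Longrightarrow> y \<in> \<sigma> \<Longrightarrow> x \<noteq> y \<Longrightarrow> E x y"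
      using l by (auto simp: \<sigma>_def distinct_card clique_complex_def)
    have "\<forall>v\<in>V. \<exists>u. non_neighbours V E v = {u}"
      using assms(4) by (simp add: card_1_singleton_iff)
    \<comment> \<open>\<open>f\<close> is the antipodal map. Symmetry of \<open>E\<close> makes each
      vertex the antipode of its antipode, whence injectivity.\<close>
    then obtain f where f: "non_neighbours V E v = {f v}" if "v \<in> V" for v
      by (auto dest!: bchoice)
    have f_sym: "f v \<in> V" "v \<in> non_neighbours V E (f v)" if "v \<in> V" for v
    proof -
      have "f v \<in> non_neighbours V E v" unfolding f[OF that] by simp
      then show "f v \<in> V" "v \<in> non_neighbours V E (f v)"
        using that assms(1) by (auto dest: sympD)
    qed
    have inj: "inj_on f \<sigma>"
    proof
      fix x y
      assume xy: "x \<in> \<sigma>" "y \<in> \<sigma>" "f x = f y"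
      then have "x \<in> V" "y \<in> V" using \<sigma> by auto
      then have "f x \<in> V" "x \<in> non_neighbours V E (f x)" "y \<in> non_neighbours V E (f x)"
        using f_sym(1)[of x] f_sym(2)[of x] f_sym(2)[of y] xy(3) by simp_all
      then show "x = y" unfolding f[OF \<open>f x \<in> V\<close>] by simp
    qed
    have "f v \<notin> \<sigma>" if v: "v \<in> \<sigma>" for v
    proof -
      have "v \<in> V" using v \<sigma>(1) by blast
      then have "f v \<in> non_neighbours V E v" by (simp only: f singletonI)
      then show ?thesis using \<sigma>(4)[OF v, of "f v"] by auto
    qed
    then have "f ` \<sigma> \<inter> \<sigma> = {}" by blast
    then have "card (f ` \<sigma> \<union> \<sigma>) = 2 * p"
      using \<sigma> inj by (simp add: card_Un_disjoint card_image)
    moreover have "f ` \<sigma> \<union> \<sigma> \<subseteq> V" using f_sym(1) \<sigma>(1) by blast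
    ultimately show False using assms(2,3) card_mono[of V "f ` \<sigma> \<union> \<sigma>"] by simp
  qed
  then show ?thesis using chain_space_zero by (auto simp: fun_eq_iff)
qed

text \<open>The fundamental cycle is built by iterated suspension \<open>v * c - v' * c\<close>.\<close>

lemma cross_polytope_cycles:
  assumes "symp E" "finite V" "card V = 2 * p" "\<And>v. v \<in> V \<Longrightarrow> card (non_neighbours V E v) = 1"
  obtains z :: "'a list \<Rightarrow> 'f::field" where "z \<noteq> (\<lambda>_. 0)"
    "cycles (clique_complex V E) p = range (\<lambda>a l. a * z l)"
proof -
  have "\<exists>z :: 'a list \<Rightarrow> 'f. z \<noteq> (\<lambda>_. 0) \<and>
      cycles (clique_complex V E) p = range (\<lambda>a l. a * z l)"
    using assms(2-4)
  proof (induction p arbitrary: V)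
    case 0
    then have V: "V = {}" by simp
    \<comment> \<open>Over the empty complex only the empty list carries a coefficient, and its
      boundary sums over no vertices: \<open>z\<close> generates the cycles of dimension -1.\<close>
    define z :: "'a list \<Rightarrow> 'f" where "z l = (if l = [] then 1 else 0)" for l
    have "cycles (clique_complex V E) 0 = range (\<lambda>a l. a * z l)"
    proof
      show "cycles (clique_complex V E) 0 \<subseteq> range (\<lambda>a l. a * z l)"
      proof
        fix c :: "'a list \<Rightarrow> 'f"
        assume "c \<in> cycles (clique_complex V E) 0"
        then have "c l = c [] * z l" for l
          by (auto simp: cycles_def chain_space_iff z_def)
        then show "c \<in> range (\<lambda>a l. a * z l)" by blast
      qed
      show "range (\<lambda>a l. a * z l) \<subseteq> cycles (clique_complex V E) 0"
        unfolding cycles_def chain_space_iff boundary_def Union_clique_complex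
        by (auto simp: V z_def alternating_def split: if_splits)
    qed
    moreover have "z [] \<noteq> 0" by (simp add: z_def)
    ultimately show ?case by (metis (no_types))
  next
    case (Suc p)
    then have "V \<noteq> {}" by auto
    then obtain v where v: "v \<in> V" by blast
    let ?K = "clique_complex V E"
    obtain v' where nv: "non_neighbours V E v = {v'}"
      using Suc.prems(3)[OF v] by (auto simp: card_1_singleton_iff)
    then have v': "v' \<in> V" "v' \<noteq> v" "\<not> E v v'" by auto
    then have "v \<in> non_neighbours V E v'" using v assms(1) by (auto dest: sympD)
    then have nv': "non_neighbours V E v' = {v}"
      using card_1_singletonE[OF Suc.prems(3)[OF v'(1)]] by (metis (no_types) singletonD)
    \<comment> \<open>Without the antipodal pair \<open>v\<close>, \<open>v'\<close> a smaller
      cross-polytope remains, and it is the link of both.\<close>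
    define L where "L = V - {v, v'}"
    have lk: "link v ?K = clique_complex L E"
      unfolding link_clique_complex[OF assms(1) v] L_def
      by (rule arg_cong[where f = "\<lambda>V. clique_complex V E"]) (use nv v' in auto)
    have lk': "link v' ?K = clique_complex L E"
      unfolding link_clique_complex[OF assms(1) v'(1)] L_def
      by (rule arg_cong[where f = "\<lambda>V. clique_complex V E"]) (use nv' v v' in auto)
    have fin: "finite (\<Union>?K)" using Suc.prems by simp
    have "card L = 2 * p" unfolding L_def using Suc.prems v v' by (simp add: card_Diff_subset)
    \<comment> \<open>Every other vertex is adjacent to \<open>v\<close> and \<open>v'\<close>, so
      its antipode survives in \<open>L\<close>.\<close>
    moreover have "card (non_neighbours L E u) = 1" if u: "u \<in> L" for u
    proof -
      have "E v u" "E v' u" using u nv nv' unfolding L_def by auto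
      then have "non_neighbours L E u = non_neighbours V E u"
        using assms(1) unfolding L_def by (auto dest: sympD)
      then show ?thesis using Suc.prems(3) u unfolding L_def by auto
    qed
    ultimately obtain a :: "'a list \<Rightarrow> 'f" where a: "a \<noteq> (\<lambda>_. 0)"
      "cycles (clique_complex L E) p = range (\<lambda>t l. t * a l)"
      using Suc.IH[of L] Suc.prems(1) unfolding L_def by auto
    have "(\<lambda>l. 1 * a l) \<in> cycles (clique_complex L E) p" unfolding a(2) by (rule rangeI)
    then have acy: "a \<in> cycles (clique_complex L E) p" by simp
    then have ach: "a \<in> chain_space (clique_complex L E) p" by (simp add: cycles_def)
    have ab: "boundary ?K a = (\<lambda>_. 0)"
      using acy boundary_mono[OF link_subset[of v ?K, unfolded lk] fin ach]
      by (simp add: cycles_def)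
    have av: "a l = 0" if "v \<in> set l" for l
      using chain_link_avoids[of a v ?K p] ach that lk by simp
    have av': "a l = 0" if "v' \<in> set l" for l
      using chain_link_avoids[of a v' ?K p] ach that lk' by simp
    \<comment> \<open>As \<open>a\<close> is a cycle, both cones have boundary \<open>a\<close>, and
      their difference is a cycle.\<close>
    define z where "z = (\<lambda>l. 1 * vertex_cone v a l + (-1) * vertex_cone v' a l)"
    have "z \<in> chain_space ?K (Suc p)"
      unfolding z_def using ach v v'
      by (intro chain_space_lincomb cone_in_chain_space)
        (auto simp: lk lk' singleton_in_clique_complex)
    moreover have "boundary ?K z = (\<lambda>_. 0)"
      unfolding z_def boundary_lincomb
      using boundary_cone[OF fin, of v a] boundary_cone[OF fin, of v' a] v v' av av' ab
      by simp
    ultimately have zcy: "z \<in> cycles ?K (Suc p)" by (simp add: cycles_def)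
    \<comment> \<open>The cone \<open>v' * a\<close> has no simplex through \<open>v\<close>, so the
      slice of \<open>z\<close> at \<open>v\<close> is \<open>a\<close>. This shows \<open>z\<close>
      nonzero and allows coefficients to be compared on slices.\<close>
    have zv: "z (v # w) = a w" for w
    proof -
      have "(\<lambda>m. a (v # m)) = (\<lambda>_. 0)" using av by auto
      then show ?thesis using v' by (simp add: z_def)
    qed
    have "z \<noteq> (\<lambda>_. 0)" using a(1) zv by auto
    moreover have "cycles ?K (Suc p) = range (\<lambda>t l. t * z l)"
    proof
      show "range (\<lambda>t l. t * z l) \<subseteq> cycles ?K (Suc p)"
        using cycles_lincomb[OF zcy zcy, of _ 0] by auto
      show "cycles ?K (Suc p) \<subseteq> range (\<lambda>t l. t * z l)"
      proof
        fix c :: "'a list \<Rightarrow> 'f"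
        assume c: "c \<in> cycles ?K (Suc p)"
        have "(\<lambda>w. c (v # w)) \<in> cycles (clique_complex L E) p"
          using cycle_slice[OF simplicial_complex_clique_complex c] Suc.prems lk by metis
        then obtain t where t: "(\<lambda>w. c (v # w)) = (\<lambda>w. t * a w)" unfolding a(2) by blast
        \<comment> \<open>The slice of \<open>c\<close> is \<open>t * a\<close>, which is also that
          of \<open>t * z\<close>. So the cycle \<open>e\<close> avoids \<open>v\<close> and lives
          on \<open>2 * p + 1\<close> vertices, too few for it not to bound.\<close>
        define e where "e = (\<lambda>l. 1 * c l + (-t) * z l)"
        have e: "e \<in> cycles ?K (Suc p)" unfolding e_def using c zcy by (rule cycles_lincomb)
        then have ech: "e \<in> chain_space ?K (Suc p)" by (simp add: cycles_def)
        have "(\<lambda>w. e (v # w)) = (\<lambda>_. 0)" unfolding e_def using zv t by (auto simp: fun_eq_iff)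
        then have "e \<in> chain_space (deletion v ?K) (Suc p)"
          using minus_cone_slice_in_chain_space[OF simplicial_complex_clique_complex
              singleton_in_clique_complex[OF v] ech] Suc.prems by simp
        then have "e \<in> cycles (clique_complex (V - {v}) E) (Suc p)"
          using boundary_mono[OF deletion_subset[of v ?K] fin, of e "Suc p"] e
          by (simp add: cycles_def deletion_clique_complex)
        moreover have "acyclic_at TYPE('f) (clique_complex (V - {v}) E) (Suc p)"
          using Suc.prems v by (intro acyclic_at_few_vertices assms(1)) auto
        ultimately have "e \<in> boundaries (clique_complex (V - {v}) E) (Suc p)"
          unfolding acyclic_at_def by blast
        then have "e \<in> boundaries ?K (Suc p)"
          by (rule subsetD[OF boundaries_mono[OF deletion_subset[of v ?K] fin,
                unfolded deletion_clique_complex]])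
        \<comment> \<open>No clique has \<open>p + 2\<close> vertices, so the chain bounded by
          \<open>e\<close> is zero, and with it \<open>e\<close>.\<close>
        moreover have "chain_space ?K (Suc (Suc p)) = {\<lambda>_. 0 :: 'f}"
          by (rule cross_polytope_chain_space[OF assms(1) Suc.prems(1) _ Suc.prems(3)])
            (simp add: Suc.prems(2))
        ultimately have "e = (\<lambda>_. 0)"
          unfolding boundaries_def boundary_def by simp
        then have "c = (\<lambda>l. t * z l)" unfolding e_def by (auto simp: fun_eq_iff)
        then show "c \<in> range (\<lambda>t l. t * z l)" by blast
      qed
    qed
    ultimately show ?case by blast
  qed
  then show thesis using that by blast
qed


section \<open>Uniqueness of the diagram\<close>

lemma linear_iso_comp:
  assumes "linear_iso U V g" "linear_iso V W h"
  shows "linear_iso U W (\<lambda>x. h (g x))"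
proof -
  have "g u \<in> vcarrier V" if "u \<in> vcarrier U" for u
    using assms(1) that by (auto simp: linear_iso_def bij_betw_def)
  then show ?thesis
    using assms bij_betw_trans[of g "vcarrier U" "vcarrier V" h "vcarrier W"]
    by (simp add: linear_iso_def comp_def)
qed

text \<open>The record \<open>vspace\<close> carries no axioms; closure of \<open>U\<close> is
  assumed so that the inverse of \<open>g\<close> cancels at sums and multiples.\<close>

lemma linear_iso_inv_into:
  assumes g: "linear_iso U V g"
    and add: "\<And>u v. u \<in> vcarrier U \<Longrightarrow> v \<in> vcarrier U \<Longrightarrow> vadd U u v \<in> vcarrier U"
    and scale: "\<And>a v. v \<in> vcarrier U \<Longrightarrow> vscale U a v \<in> vcarrier U"
  shows "linear_iso V U (inv_into (vcarrier U) g)"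
proof -
  let ?g' = "inv_into (vcarrier U) g"
  have bij: "bij_betw g (vcarrier U) (vcarrier V)" using g by (simp add: linear_iso_def)
  have g': "?g' v \<in> vcarrier U" "g (?g' v) = v" if "v \<in> vcarrier V" for v
    using bij that by (auto simp: bij_betw_def inv_into_into f_inv_into_f)
  have inv: "?g' (g u) = u" if "u \<in> vcarrier U" for u
    using bij that by (simp add: bij_betw_def)
  show ?thesis
    unfolding linear_iso_def
  proof (intro conjI ballI allI)
    show "bij_betw ?g' (vcarrier V) (vcarrier U)" using bij by (rule bij_betw_inv_into)
  next
    fix u v
    assume "u \<in> vcarrier V" "v \<in> vcarrier V"
    note u = g'[OF this(1)] and v = g'[OF this(2)]
    have "g (vadd U (?g' u) (?g' v)) = vadd V u v"
      using g u v unfolding linear_iso_def by simp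
    then show "?g' (vadd V u v) = vadd U (?g' u) (?g' v)"
      using inv[OF add[OF u(1) v(1)]] by simp
  next
    fix a v
    assume "v \<in> vcarrier V"
    note v = g'[OF this]
    have "g (vscale U a (?g' v)) = vscale V a v"
      using g v unfolding linear_iso_def by simp
    then show "?g' (vscale V a v) = vscale U a (?g' v)"
      using inv[OF scale[OF v(1), of a]] by simp
  qed
qed

lemma persistence_iso_trans:
  assumes "persistence_iso L M" "persistence_iso M N"
  shows "persistence_iso L N"
proof -
  obtain g where g: "\<And>r. r \<ge> 0 \<Longrightarrow> linear_iso (pspace L r) (pspace M r) (g r)"
    "\<And>r s v. 0 \<le> r \<Longrightarrow> r \<le> s \<Longrightarrow> v \<in> vcarrier (pspace L r) \<Longrightarrow>
      g s (pmap L r s v) = pmap M r s (g r v)"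
    using assms(1) unfolding persistence_iso_def by blast
  obtain h where h: "\<And>r. r \<ge> 0 \<Longrightarrow> linear_iso (pspace M r) (pspace N r) (h r)"
    "\<And>r s v. 0 \<le> r \<Longrightarrow> r \<le> s \<Longrightarrow> v \<in> vcarrier (pspace M r) \<Longrightarrow>
      h s (pmap M r s v) = pmap N r s (h r v)"
    using assms(2) unfolding persistence_iso_def by blast
  have "g r v \<in> vcarrier (pspace M r)" if "r \<ge> 0" "v \<in> vcarrier (pspace L r)" for r v
    using g(1)[OF that(1)] that(2) by (auto simp: linear_iso_def bij_betw_def)
  then show ?thesis
    unfolding persistence_iso_def
    using g(2) h(2) linear_iso_comp[OF g(1) h(1)]
    by (intro exI[of _ "\<lambda>r x. h r (g r x)"]) simp
qed

lemma interval_sum_closed: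
  fixes u v :: "nat \<Rightarrow> 'f::field"
  assumes "u \<in> vcarrier (pspace (interval_sum bars) r)"
  shows "v \<in> vcarrier (pspace (interval_sum bars) r) \<Longrightarrow>
      vadd (pspace (interval_sum bars) r) u v \<in> vcarrier (pspace (interval_sum bars) r)"
    and "vscale (pspace (interval_sum bars) r) a u \<in> vcarrier (pspace (interval_sum bars) r)"
proof -
  have "u i \<noteq> 0 \<or> v i \<noteq> 0" if "u i + v i \<noteq> 0" for i using that by auto
  then show "v \<in> vcarrier (pspace (interval_sum bars) r) \<Longrightarrow>
      vadd (pspace (interval_sum bars) r) u v \<in> vcarrier (pspace (interval_sum bars) r)"
    using assms unfolding interval_sum_def by simp blast
qed (use assms in \<open>simp add: interval_sum_def\<close>)

lemma persistence_iso_interval_sum_sym: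
  assumes "persistence_iso (interval_sum bars) M"
  shows "persistence_iso M (interval_sum bars)"
proof -
  let ?I = "interval_sum bars"
  obtain g where g: "\<And>r. r \<ge> 0 \<Longrightarrow> linear_iso (pspace ?I r) (pspace M r) (g r)"
    "\<And>r s v. 0 \<le> r \<Longrightarrow> r \<le> s \<Longrightarrow> v \<in> vcarrier (pspace ?I r) \<Longrightarrow>
      g s (pmap ?I r s v) = pmap M r s (g r v)"
    using assms unfolding persistence_iso_def by blast
  define h where "h r = inv_into (vcarrier (pspace ?I r)) (g r)" for r
  show ?thesis
    unfolding persistence_iso_def
  proof (intro exI conjI allI impI ballI)
    fix r :: real
    assume "0 \<le> r"
    then show "linear_iso (pspace M r) (pspace ?I r) (h r)"
      unfolding h_def by (intro linear_iso_inv_into g interval_sum_closed)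
  next
    fix r s :: real and v
    assume rs: "0 \<le> r" "r \<le> s" and v: "v \<in> vcarrier (pspace M r)"
    have bij: "bij_betw (g r) (vcarrier (pspace ?I r)) (vcarrier (pspace M r))"
      "bij_betw (g s) (vcarrier (pspace ?I s)) (vcarrier (pspace M s))"
      using g(1) rs by (auto simp: linear_iso_def)
    have u: "h r v \<in> vcarrier (pspace ?I r)" "g r (h r v) = v"
      using bij(1) v unfolding h_def by (auto simp: bij_betw_def inv_into_into f_inv_into_f)
    have "pmap ?I r s (h r v) \<in> vcarrier (pspace ?I s)"
      using u(1) by (auto simp: interval_sum_def split: if_splits)
    then have "h s (g s (pmap ?I r s (h r v))) = pmap ?I r s (h r v)"
      using bij(2) unfolding h_def by (simp add: bij_betw_def)
    then show "h s (pmap M r s v) = pmap ?I r s (h r v)"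
      using g(2)[OF rs u(1)] u(2) by simp
  qed
qed

text \<open>The dimension at a parameter counts the bars containing it: at most one everywhere, and
  none outside \<open>[b, d)\<close>. The structure maps then force the same bar at all parameters
  of \<open>[b, d)\<close>.\<close>

lemma interval_sum_single_unique:
  fixes bars :: "(real \<times> real) list" and b d :: real
  assumes iso: "persistence_iso (interval_sum [(b, d)] :: ('f::field, nat \<Rightarrow> 'f) persistence_module)
      (interval_sum bars)"
    and bd: "0 \<le> b" "b < d" and bars: "\<forall>(b, d)\<in>set bars. 0 \<le> b \<and> b < d"
  shows "mset bars = {#(b, d)#}"
proof -
  let ?I = "interval_sum [(b, d)] :: ('f, nat \<Rightarrow> 'f) persistence_module"
  let ?J = "interval_sum bars :: ('f, nat \<Rightarrow> 'f) persistence_module"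
  obtain h where h: "\<And>r. r \<ge> 0 \<Longrightarrow> linear_iso (pspace ?I r) (pspace ?J r) (h r)"
    "\<And>r s v. 0 \<le> r \<Longrightarrow> r \<le> s \<Longrightarrow> v \<in> vcarrier (pspace ?I r) \<Longrightarrow>
      h s (pmap ?I r s v) = pmap ?J r s (h r v)"
    using iso unfolding persistence_iso_def by blast
  define covers where
    "covers i r \<longleftrightarrow> i < length bars \<and> fst (bars ! i) \<le> r \<and> r < snd (bars ! i)" for i r
  define e :: "nat \<Rightarrow> nat \<Rightarrow> 'f" where "e i j = (if j = i then 1 else 0)" for i j
  have I: "vcarrier (pspace ?I r) =
      (if b \<le> r \<and> r < d then range (\<lambda>a j. a * e 0 j) else {\<lambda>_. 0})" for r
  proof -
    have carrier: "vcarrier (pspace ?I r) = {g. \<forall>i. g i \<noteq> 0 \<longrightarrow> i = 0 \<and> b \<le> r \<and> r < d}"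
      by (auto simp: interval_sum_def)
    have "g \<in> range (\<lambda>a j. a * e 0 j)" if "\<And>i. g i \<noteq> 0 \<Longrightarrow> i = 0" for g :: "nat \<Rightarrow> 'f"
    proof (rule range_eqI)
      show "g = (\<lambda>j. g 0 * e 0 j)" using that by (force simp: e_def)
    qed
    then show ?thesis
      unfolding carrier by (auto simp: e_def split: if_splits)
  qed
  have J: "vcarrier (pspace ?J r) = {g. \<forall>i. g i \<noteq> 0 \<longrightarrow> covers i r}" for r
    by (auto simp: interval_sum_def covers_def)
  \<comment> \<open>\<open>linear_iso\<close> does not mention zero vectors; they correspond by
    scaling with \<open>0\<close>.\<close>
  have h0: "h r (\<lambda>_. 0) = (\<lambda>_. 0)" if "r \<ge> 0" for r
  proof -
    have z: "(\<lambda>_. 0) \<in> vcarrier (pspace ?I r)" by (simp add: interval_sum_def)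
    have "h r (vscale (pspace ?I r) 0 (\<lambda>_. 0)) = vscale (pspace ?J r) 0 (h r (\<lambda>_. 0))"
      using h(1)[OF that] z unfolding linear_iso_def by blast
    then show ?thesis by (simp add: interval_sum_def)
  qed
  have onto: "vcarrier (pspace ?J r) = h r ` vcarrier (pspace ?I r)"
    and inj: "inj_on (h r) (vcarrier (pspace ?I r))" if "r \<ge> 0" for r
    using h(1)[OF that] by (auto simp: linear_iso_def bij_betw_def)
  \<comment> \<open>Outside \<open>[b, d)\<close> the target is the image of a zero space, whereas a
    bar containing \<open>r\<close> contributes the nonzero vector \<open>e i\<close>.\<close>
  have inside: "b \<le> r \<and> r < d" if "r \<ge> 0" "covers i r" for i r
  proof (rule ccontr)
    assume "\<not> (b \<le> r \<and> r < d)"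
    then have "vcarrier (pspace ?J r) = {\<lambda>_. 0}"
      using onto[OF that(1)] h0[OF that(1)] I[of r] by auto
    moreover have "e i \<in> vcarrier (pspace ?J r)" using that(2) by (simp add: J e_def)
    ultimately have "e i i = 0" by auto
    then show False by (simp add: e_def)
  qed
  have e0: "(\<lambda>j. a * e 0 j) \<in> vcarrier (pspace ?I r)" if "b \<le> r" "r < d" for r a
    using that I[of r] by auto
  have e0': "e 0 \<in> vcarrier (pspace ?I r)" if "b \<le> r" "r < d" for r
    using e0[OF that, of 1] by simp
  have h_scale: "h r (\<lambda>j. a * e 0 j) = (\<lambda>j. a * h r (e 0) j)" if "b \<le> r" "r < d" for r a
  proof -
    have "h r (vscale (pspace ?I r) a (e 0)) = vscale (pspace ?J r) a (h r (e 0))"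
      using h(1)[of r] e0'[OF that] that bd unfolding linear_iso_def by auto
    then show ?thesis by (simp add: interval_sum_def)
  qed
  \<comment> \<open>Two bars over \<open>r\<close> would put the independent vectors
    \<open>e i\<close> and \<open>e j\<close> into a space spanned by
    \<open>h r (e 0)\<close>.\<close>
  have unique: "i = j" if "r \<ge> 0" "covers i r" "covers j r" for i j r
  proof (rule ccontr)
    assume "i \<noteq> j"
    have r: "b \<le> r" "r < d" using inside that by auto
    have gen: "\<exists>a. g = (\<lambda>j. a * h r (e 0) j)" if "g \<in> vcarrier (pspace ?J r)" for g
      using that onto[OF \<open>r \<ge> 0\<close>] I[of r] h_scale[OF r] r by auto
    have "e i \<in> vcarrier (pspace ?J r)" "e j \<in> vcarrier (pspace ?J r)"
      using that by (auto simp: J e_def)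
    then obtain \<alpha> \<beta> where \<alpha>: "e i = (\<lambda>j. \<alpha> * h r (e 0) j)" and \<beta>: "e j = (\<lambda>j. \<beta> * h r (e 0) j)"
      using gen by meson
    have "\<alpha> * h r (e 0) i = 1" "\<alpha> * h r (e 0) j = 0" "\<beta> * h r (e 0) j = 1"
      using fun_cong[OF \<alpha>, of i] fun_cong[OF \<alpha>, of j] fun_cong[OF \<beta>, of j] \<open>i \<noteq> j\<close>
      by (simp_all add: e_def)
    then show False by auto
  qed
  have nz: "h r (e 0) \<noteq> (\<lambda>_. 0)" if "b \<le> r" "r < d" for r
  proof
    assume "h r (e 0) = (\<lambda>_. 0)"
    then have "h r (e 0) = h r (\<lambda>_. 0)" using h0[of r] that bd by simp
    then have "e 0 = (\<lambda>_. 0)"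
      using inj[of r] e0'[OF that] e0[OF that, of 0] that bd by (auto dest: inj_onD)
    then have "e 0 0 = 0" by (rule fun_cong)
    then show False by (simp add: e_def)
  qed
  have "h b (e 0) \<in> vcarrier (pspace ?J b)"
    using onto[OF bd(1)] e0'[of b] bd by simp
  moreover obtain i where "h b (e 0) i \<noteq> 0" using nz[of b] bd by auto
  ultimately have i: "covers i b" by (simp add: J)
  \<comment> \<open>The generator survives from \<open>b\<close> to \<open>s\<close>, and the maps
    of \<open>interval_sum\<close> only keep or kill coordinates. A coordinate nonzero at
    \<open>s\<close> was nonzero at \<open>b\<close>, where \<open>i\<close> is the only
    bar.\<close>
  have covers_i: "covers i s" if s: "b \<le> s" "s < d" for s
  proof -
    have "pmap ?I b s (e 0) = e 0"
      using s by (auto simp: interval_sum_def e_def)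
    then have hs: "h s (e 0) = pmap ?J b s (h b (e 0))"
      using h(2)[OF bd(1) s(1) e0'[OF order_refl bd(2)]] by simp
    obtain j where j: "h s (e 0) j \<noteq> 0" using nz[OF s] by auto
    then have "h b (e 0) j \<noteq> 0"
      unfolding hs by (auto simp: interval_sum_def split: if_splits)
    then have "covers j b"
      using \<open>h b (e 0) \<in> vcarrier (pspace ?J b)\<close> by (simp add: J)
    then have "j = i" using unique[OF bd(1)] i by blast
    moreover have "h s (e 0) \<in> vcarrier (pspace ?J s)"
      using onto[of s] e0'[OF s] bd s by simp
    ultimately show ?thesis using j by (simp add: J)
  qed
  have bar: "0 \<le> fst (bars ! j) \<and> fst (bars ! j) < snd (bars ! j)" if "j < length bars" for j
    using bars nth_mem[OF that] by (auto simp: case_prod_beta)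
  \<comment> \<open>A bar contains its own left end, which lies in \<open>[b, d)\<close> and is
    covered by bar \<open>i\<close> too.\<close>
  have only_i: "j = i" if j: "j < length bars" for j
  proof -
    have "covers j (fst (bars ! j))" using bar[OF j] j by (simp add: covers_def)
    then show ?thesis
      using inside[of "fst (bars ! j)" j] covers_i[of "fst (bars ! j)"]
        unique[of "fst (bars ! j)" j i] bar[OF j] by blast
  qed
  have "i < length bars" using i by (simp add: covers_def)
  then have "i = 0" using only_i[of 0] by linarith
  then have "length bars = 1" using only_i[of 1] \<open>i < length bars\<close> by linarith
  then obtain b' d' where b': "bars = [(b', d')]"
    by (auto simp: length_Suc_conv)
  have "b' < d'" "0 \<le> b'" using bars b' by auto
  moreover have "b \<le> b'" using inside[of b' 0] calculation by (simp add: covers_def b')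
  moreover have "b' \<le> b" using i \<open>i = 0\<close> by (simp add: covers_def b')
  \<comment> \<open>Right ends are excluded: if the bar covered \<open>d\<close>, then
    \<open>inside\<close> would give \<open>d < d\<close>; if \<open>d' < d\<close>, the bar would
    cover its own end \<open>d'\<close>.\<close>
  moreover have "d' \<le> d"
    using inside[of d 0] bd calculation by (fastforce simp: covers_def b')
  moreover have "d \<le> d'"
    using covers_i[of d'] calculation \<open>i = 0\<close> by (fastforce simp: covers_def b')
  ultimately show ?thesis using b' by simp
qed

lemma persistence_diagram_single:
  assumes "persistence_iso (interval_sum [(b, d)]) M" "0 \<le> b" "b < d"
  shows "persistence_diagram M = {#(b, d)#}"
  unfolding persistence_diagram_def
proof (rule the_equality)
  show "\<exists>bars. {#(b, d)#} = mset bars \<and> (\<forall>(b, d)\<in>set bars. 0 \<le> b \<and> b < d) \<and>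
      persistence_iso M (interval_sum bars)"
    using assms persistence_iso_interval_sum_sym by (intro exI[of _ "[(b, d)]"]) auto
next
  fix D
  assume "\<exists>bars. D = mset bars \<and> (\<forall>(b, d)\<in>set bars. 0 \<le> b \<and> b < d) \<and>
      persistence_iso M (interval_sum bars)"
  then show "D = {#(b, d)#}"
    using interval_sum_single_unique persistence_iso_trans[OF assms(1)] assms(2,3) by blast
qed

text \<open>A zero space is a singleton whose element may be any object, such as a coset. A bar
  would contribute two distinct vectors at its left end.\<close>

lemma persistence_diagram_empty:
  fixes M :: "('f::field, 'v) persistence_module"
  assumes "\<And>r. r \<ge> 0 \<Longrightarrow> \<exists>w. vcarrier (pspace M r) = {w}"
  shows "persistence_diagram M = {#}"
  unfolding persistence_diagram_def
proof (rule the_equality)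
  have "linear_iso (pspace M r) (pspace (interval_sum []) r) (\<lambda>_ _. 0)" if "r \<ge> 0" for r
    using assms[OF that] by (auto simp: linear_iso_def interval_sum_def bij_betw_def)
  then have "persistence_iso M (interval_sum [])"
    unfolding persistence_iso_def
    by (intro exI[of _ "\<lambda>_ _ _. 0"]) (auto simp: interval_sum_def)
  then show "\<exists>bars. {#} = mset bars \<and> (\<forall>(b, d)\<in>set bars. 0 \<le> b \<and> b < d) \<and>
      persistence_iso M (interval_sum bars)"
    by (intro exI[of _ "[]"]) auto
next
  fix D
  assume "\<exists>bars. D = mset bars \<and> (\<forall>(b, d)\<in>set bars. 0 \<le> b \<and> b < d) \<and>
      persistence_iso M (interval_sum bars)"
  then obtain bars where D: "D = mset bars" and bars: "\<forall>(b, d)\<in>set bars. 0 \<le> b \<and> b < d"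
    and iso: "persistence_iso M (interval_sum bars)"
    by blast
  have "bars = []"
  proof (rule ccontr)
    assume "bars \<noteq> []"
    then obtain b d where bd: "bars ! 0 = (b, d)" "0 < length bars" "0 \<le> b" "b < d"
      using bars by (cases bars) auto
    let ?J = "pspace (interval_sum bars) b :: ('f, nat \<Rightarrow> 'f) vspace"
    obtain h where "linear_iso (pspace M b) ?J h"
      using iso bd(3) unfolding persistence_iso_def by auto
    then have "vcarrier ?J = h ` vcarrier (pspace M b)" by (simp add: linear_iso_def bij_betw_def)
    moreover obtain v where "vcarrier (pspace M b) = {v}" using assms[OF bd(3)] by blast
    ultimately have w: "vcarrier ?J = {h v}" by simp
    have "(\<lambda>_. 0) \<in> vcarrier ?J" "(\<lambda>i. if i = 0 then 1 else 0) \<in> vcarrier ?J"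
      using bd by (auto simp: interval_sum_def)
    then have "(\<lambda>_. 0) = (\<lambda>i::nat. if i = 0 then 1 else 0 :: 'f)" unfolding w by simp
    then show False by (metis zero_neq_one)
  qed
  then show "D = {#}" using D by simp
qed


section \<open>Persistence of a filtration\<close>

lemma mem_coset: "x \<in> u +o W \<longleftrightarrow> (\<lambda>i. x i - u i) \<in> W" for u x :: "'i \<Rightarrow> 'f::field"
proof
  assume "x \<in> u +o W"
  then obtain w where "w \<in> W" "x = u + w" by (auto simp: elt_set_plus_def)
  then show "(\<lambda>i. x i - u i) \<in> W" by simp
next
  assume "(\<lambda>i. x i - u i) \<in> W"
  moreover have "x = u + (\<lambda>i. x i - u i)" by auto
  ultimately show "x \<in> u +o W" unfolding elt_set_plus_def by blast
qed

context
  fixes W :: "('i \<Rightarrow> 'f::field) set"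
  assumes zero: "(\<lambda>_. 0) \<in> W"
    and lincomb: "\<And>u v a b. u \<in> W \<Longrightarrow> v \<in> W \<Longrightarrow> (\<lambda>i. a * u i + b * v i) \<in> W"
begin

text \<open>Serves two purposes: with \<open>V = W\<close> it evaluates \<open>vscale\<close> of a
  quotient, with \<open>a = 1\<close> the inclusion map from the quotient by a smaller space
  \<open>V\<close>.\<close>

lemma UN_coset:
  assumes "V \<subseteq> W" "(\<lambda>_. 0) \<in> V"
  shows "(\<Union>u\<in>x +o V. (\<lambda>i. a * u i) +o W) = (\<lambda>i. a * x i) +o W"
proof (intro equalityI subsetI)
  fix y
  assume "y \<in> (\<Union>u\<in>x +o V. (\<lambda>i. a * u i) +o W)"
  then obtain u where "(\<lambda>i. u i - x i) \<in> W" "(\<lambda>i. y i - a * u i) \<in> W"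
    using assms(1) by (auto simp: mem_coset)
  from lincomb[OF this, of a 1] show "y \<in> (\<lambda>i. a * x i) +o W"
    by (simp add: mem_coset algebra_simps)
next
  fix y
  assume "y \<in> (\<lambda>i. a * x i) +o W"
  moreover have "x \<in> x +o V" using assms(2) by (simp add: mem_coset)
  ultimately show "y \<in> (\<Union>u\<in>x +o V. (\<lambda>i. a * u i) +o W)" by blast
qed

lemma coset_add: "(u +o W) + (v +o W) = (\<lambda>i. u i + v i) +o W"
proof (intro equalityI subsetI)
  fix y
  assume "y \<in> (u +o W) + (v +o W)"
  then obtain s t where y: "y = (\<lambda>i. s i + t i)" and "(\<lambda>i. s i - u i) \<in> W" "(\<lambda>i. t i - v i) \<in> W"
    by (fastforce simp: set_plus_def mem_coset plus_fun_def)
  from lincomb[OF this(2,3), of 1 1] show "y \<in> (\<lambda>i. u i + v i) +o W"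
    by (simp add: mem_coset y algebra_simps)
next
  fix y
  assume "y \<in> (\<lambda>i. u i + v i) +o W"
  then have "(\<lambda>i. y i - v i) \<in> u +o W" by (simp add: mem_coset algebra_simps)
  moreover have "v \<in> v +o W" using zero by (simp add: mem_coset)
  moreover have "y = (\<lambda>i. y i - v i) + v" by auto
  ultimately show "y \<in> (u +o W) + (v +o W)" unfolding set_plus_def by blast
qed

lemma coset_absorb: "u \<in> W \<Longrightarrow> u +o W = W"
proof (intro equalityI subsetI)
  fix y
  assume u: "u \<in> W"
  {
    assume "y \<in> u +o W"
    then show "y \<in> W" using lincomb[OF _ u, of "\<lambda>i. y i - u i" 1 1] by (simp add: mem_coset)
  next
    assume "y \<in> W"
    then show "y \<in> u +o W" using lincomb[OF _ u, of y 1 "-1"] by (simp add: mem_coset)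
  }
qed

end

lemma reduced_homology_acyclic:
  assumes "acyclic_at TYPE('f::field) K (k + 1)"
  shows "vcarrier (reduced_homology K k :: ('f, ('a list \<Rightarrow> 'f) set) vspace)
    = {boundaries K (k + 1)}"
proof -
  have "u +o boundaries K (k + 1) = boundaries K (k + 1)"
    if "u \<in> cycles K (k + 1)" for u :: "'a list \<Rightarrow> 'f"
    using assms that
    by (intro coset_absorb boundaries_zero boundaries_lincomb) (auto simp: acyclic_at_def)
  then show ?thesis
    using cycles_zero[of K "k + 1"] by (force simp: reduced_homology_def quotient_space_def)
qed

text \<open>A single cycle \<open>z\<close> generates the homology on the whole interval, so taking
  classes of its multiples commutes with the inclusions. Outside the interval both modules
  vanish.\<close>

lemma filtration_single_interval:
  fixes z :: "'a list \<Rightarrow> 'f::field" and K :: "real \<Rightarrow> 'a set set"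
  assumes mono: "\<And>r s. 0 \<le> r \<Longrightarrow> r \<le> s \<Longrightarrow> K r \<subseteq> K s" and fin: "\<And>r. finite (\<Union>(K r))"
    and z: "z \<noteq> (\<lambda>_. 0)"
    and cyc: "\<And>r. 0 \<le> r \<Longrightarrow> b \<le> r \<Longrightarrow> r < d \<Longrightarrow> cycles (K r) (k + 1) = range (\<lambda>a l. a * z l)"
    and bdr: "\<And>r. 0 \<le> r \<Longrightarrow> b \<le> r \<Longrightarrow> r < d \<Longrightarrow>
      (boundaries (K r) (k + 1) :: ('a list \<Rightarrow> 'f) set) = {\<lambda>_. 0}"
    and acyc: "\<And>r. 0 \<le> r \<Longrightarrow> \<not> (b \<le> r \<and> r < d) \<Longrightarrow> acyclic_at TYPE('f) (K r) (k + 1)"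
  shows "persistence_iso (interval_sum [(b, d)])
    \<lparr>pspace = (\<lambda>r. reduced_homology (K r) k :: ('f, ('a list \<Rightarrow> 'f) set) vspace),
     pmap = (\<lambda>r s. inclusion_map (K s) k)\<rparr>"
proof -
  define W where "W r = (boundaries (K r) (k + 1) :: ('a list \<Rightarrow> 'f) set)" for r
  have W: "(\<lambda>_. 0) \<in> W r" "\<And>u v a b. u \<in> W r \<Longrightarrow> v \<in> W r \<Longrightarrow> (\<lambda>i. a * u i + b * v i) \<in> W r" for r
    unfolding W_def by (rule boundaries_zero, rule boundaries_lincomb)
  \<comment> \<open>Off the interval the coordinate \<open>g 0\<close> is 0, and
    \<open>h r g\<close> is the zero class \<open>W r\<close>.\<close>
  define h :: "real \<Rightarrow> (nat \<Rightarrow> 'f) \<Rightarrow> ('a list \<Rightarrow> 'f) set"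
    where "h r g = (\<lambda>l. g 0 * z l) +o W r" for r g
  let ?I = "interval_sum [(b, d)] :: ('f, nat \<Rightarrow> 'f) persistence_module"
  have I: "vcarrier (pspace ?I r) = {g. \<forall>i. g i \<noteq> 0 \<longrightarrow> i = 0 \<and> b \<le> r \<and> r < d}" for r
    by (auto simp: interval_sum_def)
  obtain l0 where l0: "z l0 \<noteq> 0" using z by auto
  have bij: "bij_betw (h r) (vcarrier (pspace ?I r)) (vcarrier (reduced_homology (K r) k))"
    if r: "0 \<le> r" for r
  proof (cases "b \<le> r \<and> r < d")
    case True
    then have Wr: "W r = {\<lambda>_. 0}" and cr: "cycles (K r) (k + 1) = range (\<lambda>a l. a * z l)"
      using r bdr cyc by (auto simp: W_def)
    have hr: "h r g = {\<lambda>l. g 0 * z l}" for g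
      by (auto simp: h_def Wr elt_set_plus_def)
    have "inj_on (h r) (vcarrier (pspace ?I r))"
    proof
      fix f g
      assume fg: "f \<in> vcarrier (pspace ?I r)" "g \<in> vcarrier (pspace ?I r)" "h r f = h r g"
      then have "f 0 * z l0 = g 0 * z l0" unfolding hr by (auto dest: fun_cong)
      then have "f 0 = g 0" using l0 by simp
      show "f = g"
      proof
        fix i
        show "f i = g i"
        proof (cases "i = 0")
          case False
          then have "f i = 0" "g i = 0" using fg(1,2) unfolding I by blast+
          then show ?thesis by simp
        qed (simp add: \<open>f 0 = g 0\<close>)
      qed
    qed
    moreover have "h r ` vcarrier (pspace ?I r) = vcarrier (reduced_homology (K r) k)"
    proof -
      have "vcarrier (reduced_homology (K r) k) = range (\<lambda>a. {\<lambda>l. a * z l})"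
        unfolding reduced_homology_def quotient_space_def cr W_def[symmetric] Wr
        by (auto simp: elt_set_plus_def image_image)
      moreover have "range (\<lambda>a. {\<lambda>l. a * z l}) \<subseteq> h r ` vcarrier (pspace ?I r)"
      proof
        fix P
        assume "P \<in> range (\<lambda>a. {\<lambda>l. a * z l})"
        then obtain a where "P = h r (\<lambda>i. if i = 0 then a else 0)" by (auto simp: hr)
        moreover have "(\<lambda>i. if i = 0 then a else 0) \<in> vcarrier (pspace ?I r)"
          using True by (simp add: I)
        ultimately show "P \<in> h r ` vcarrier (pspace ?I r)" by blast
      qed
      ultimately show ?thesis by (auto simp: hr)
    qed
    ultimately show ?thesis by (simp add: bij_betw_def)
  next
    case False
    have "vcarrier (reduced_homology (K r) k) = {W r}"
      using reduced_homology_acyclic[OF acyc[OF r False]] by (simp add: W_def)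
    moreover have "vcarrier (pspace ?I r) = {\<lambda>_. 0}" using False I[of r] by auto
    moreover have "h r (\<lambda>_. 0) = W r" using W(1) by (auto simp: h_def mem_coset)
    ultimately show ?thesis by (simp add: bij_betw_def)
  qed
  have add: "h r (\<lambda>i. f i + g i) = h r f + h r g" for r f g
    unfolding h_def by (subst coset_add) (auto simp: W algebra_simps)
  have scale: "h r (\<lambda>i. a * g i) = (\<Union>u\<in>h r g. (\<lambda>i. a * u i) +o W r)" for r a g
    unfolding h_def by (subst UN_coset) (auto simp: W algebra_simps)
  have comm: "h s (pmap ?I r s g) = (\<Union>u\<in>h r g. u +o W s)"
    if rs: "0 \<le> r" "r \<le> s" and g: "g \<in> vcarrier (pspace ?I r)" for r s g
  proof -
    have "W r \<subseteq> W s"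
      unfolding W_def using mono[OF rs] fin by (rule boundaries_mono)
    \<comment> \<open>The ambiguity \<open>W r\<close> of the representative is absorbed by the
      larger space \<open>W s\<close>.\<close>
    then have *: "(\<Union>u\<in>h r g. u +o W s) = (\<lambda>l. g 0 * z l) +o W s"
      using UN_coset[where W = "W s" and V = "W r" and a = 1] W by (simp add: h_def)
    show ?thesis
    proof (cases "b \<le> s \<and> s < d")
      case True
      then show ?thesis unfolding * by (simp add: h_def interval_sum_def)
    next
      case False
      \<comment> \<open>The class dies at \<open>s\<close>: a multiple of \<open>z\<close> remains a
        cycle in the acyclic complex \<open>K s\<close>, and for \<open>r\<close> outside the
        interval the coordinate is already 0.\<close>
      have "(\<lambda>l. g 0 * z l) \<in> W s"
      proof (cases "b \<le> r \<and> r < d")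
        case True
        then have "(\<lambda>l. g 0 * z l) \<in> cycles (K r) (k + 1)" using cyc rs(1) by blast
        then have "(\<lambda>l. g 0 * z l) \<in> cycles (K s) (k + 1)"
          using cycles_mono[OF mono[OF rs] fin] by blast
        then show ?thesis
          using acyc[OF _ False] rs unfolding acyclic_at_def W_def by auto
      next
        case False
        then have "g 0 = 0" using g unfolding I by blast
        then show ?thesis using W(1) by simp
      qed
      then have "(\<lambda>l. g 0 * z l) +o W s = W s" using W by (intro coset_absorb)
      moreover have "h s (pmap ?I r s g) = W s"
        using False W(1) by (auto simp: h_def interval_sum_def mem_coset)
      ultimately show ?thesis unfolding * by simp
    qed
  qed
  show ?thesis
    unfolding persistence_iso_def
  proof (intro exI[of _ h] conjI allI impI ballI, goal_cases)
    case (1 r)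
    have "vadd (pspace ?I r) = (\<lambda>f g i. f i + g i)" "vscale (pspace ?I r) = (\<lambda>a g i. a * g i)"
      by (simp_all add: interval_sum_def)
    then show ?case
      using bij[OF 1] add scale
      by (simp add: linear_iso_def reduced_homology_def quotient_space_def W_def)
  next
    case (2 r s v)
    then show ?case using comm by (simp add: inclusion_map_def W_def)
  qed
qed


section \<open>Vietoris--Rips complexes\<close>

text \<open>The diameter of a finite set is a maximum of distances; \<open>0 \<le> r\<close> takes
  care of pairs of equal points.\<close>

lemma VR_eq_clique_complex:
  assumes "Metric_space X d" "finite X" "0 \<le> r"
  shows "VR X d r = clique_complex X (\<lambda>x y. d x y \<le> r)"
proof -
  interpret Metric_space X d by (rule assms)
  have "diam_of d S \<le> r \<longleftrightarrow> (\<forall>x\<in>S. \<forall>y\<in>S. x \<noteq> y \<longrightarrow> d x y \<le> r)" if S: "S \<subseteq> X" "S \<noteq> {}" for S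
  proof -
    have "finite S" using S assms(2) finite_subset by blast
    then have "diam_of d S \<le> r \<longleftrightarrow> (\<forall>x\<in>S. \<forall>y\<in>S. d x y \<le> r)"
      unfolding diam_of_def using S(2) by (subst if_not_P) (auto simp: cSup_eq_Max)
    moreover have "d x y \<le> r" if "x \<in> S" "x = y" for x y
      using that S(1) assms(3) by (auto simp: subset_iff)
    ultimately show ?thesis by blast
  qed
  then show ?thesis by (auto simp: VR_def clique_complex_def)
qed

text \<open>A farthest point of \<open>X\<close>, followed by a farthest one among the rest, is a
  witness for the choice operator.\<close>

lemma farthest_pair:
  assumes "finite X" "card X \<ge> 2" "farthest_pair X d x = (x1, x2)"
  shows "x1 \<in> X" "x2 \<in> X" "x1 \<noteq> x2" "d x x2 \<le> d x x1" "\<And>a. a \<in> X - {x1, x2} \<Longrightarrow> d x a \<le> d x x2"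
proof -
  have max: "\<exists>y\<in>A. \<forall>a\<in>A. d x a \<le> d x y" if "finite A" "A \<noteq> {}" for A
  proof -
    have "Max (d x ` A) \<in> d x ` A" using that by (intro Max_in) auto
    then obtain y where "y \<in> A" "Max (d x ` A) = d x y" by blast
    moreover have "\<forall>a\<in>A. d x a \<le> Max (d x ` A)" using that by simp
    ultimately show ?thesis by auto
  qed
  have "X \<noteq> {}" using assms by auto
  then obtain y1 where y1: "y1 \<in> X" "\<forall>a\<in>X. d x a \<le> d x y1"
    using max[OF assms(1)] by blast
  have "card (X - {y1}) \<ge> 1" using assms y1 by simp
  then have "X - {y1} \<noteq> {}" by (metis card.empty not_one_le_zero)
  then obtain y2 where y2: "y2 \<in> X - {y1}" "\<forall>a\<in>X - {y1}. d x a \<le> d x y2"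
    using max[of "X - {y1}"] assms(1) by blast
  let ?P = "\<lambda>(x1, x2). x1 \<in> X \<and> x2 \<in> X \<and> x1 \<noteq> x2 \<and> d x x1 \<ge> d x x2 \<and>
        (\<forall>a\<in>X - {x1, x2}. d x x2 \<ge> d x a)"
  have "?P (y1, y2)" using y1 y2 by auto
  then have "?P (farthest_pair X d x)" unfolding farthest_pair_def by (rule someI)
  then show "x1 \<in> X" "x2 \<in> X" "x1 \<noteq> x2" "d x x2 \<le> d x x1"
    "\<And>a. a \<in> X - {x1, x2} \<Longrightarrow> d x a \<le> d x x2"
    unfolding assms(3) by auto
qed

text \<open>If any point is farther than \<open>r\<close>, then so is \<open>x1\<close>; there is a
  second such point exactly if \<open>x2\<close> is one.\<close>

lemma card_far_points:
  assumes "finite X" "card X \<ge> 2"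
  shows "card {y\<in>X. r < d x y} = 1 \<longleftrightarrow> tb_pt X d x \<le> r \<and> r < td_pt X d x"
proof -
  obtain x1 x2 where p: "farthest_pair X d x = (x1, x2)" by fastforce
  note fp = farthest_pair[OF assms p]
  have t: "tb_pt X d x = d x x2" "td_pt X d x = d x x1" by (simp_all add: tb_pt_def td_pt_def p)
  have max: "d x y \<le> d x x1" if "y \<in> X" for y
    using fp(4) fp(5)[of y] that by (cases "y = x1 \<or> y = x2") auto
  show ?thesis
  proof
    assume "card {y\<in>X. r < d x y} = 1"
    then obtain y where y: "{y\<in>X. r < d x y} = {y}" by (auto simp: card_1_singleton_iff)
    then have "r < d x y" "y \<in> X" by auto
    then have "r < d x x1" using max[of y] by simp
    then have "x1 \<in> {y\<in>X. r < d x y}" using fp(1) by simp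
    then have "x1 = y" unfolding y by simp
    moreover have "x2 = y" if "r < d x x2"
    proof -
      have "x2 \<in> {y\<in>X. r < d x y}" using fp(2) that by simp
      then show ?thesis unfolding y by simp
    qed
    ultimately have "\<not> r < d x x2" using fp(3) by blast
    then show "tb_pt X d x \<le> r \<and> r < td_pt X d x" using \<open>r < d x x1\<close> by (simp add: t)
  next
    assume r: "tb_pt X d x \<le> r \<and> r < td_pt X d x"
    have "{y\<in>X. r < d x y} = {x1}"
      using fp r unfolding t by (force simp: not_less[symmetric])
    then show "card {y\<in>X. r < d x y} = 1" by simp
  qed
qed

lemma tb_le_iff_less_td:
  assumes "finite X" "card X \<ge> 2"
  shows "(\<forall>x\<in>X. card {y\<in>X. r < d x y} = 1) \<longleftrightarrow> tb X d \<le> r \<and> r < td X d"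
proof -
  have "X \<noteq> {}" using assms by auto
  moreover have "(\<forall>x\<in>X. card {y\<in>X. r < d x y} = 1) \<longleftrightarrow> (\<forall>x\<in>X. tb_pt X d x \<le> r \<and> r < td_pt X d x)"
    by (simp only: card_far_points[OF assms])
  ultimately show ?thesis using assms(1) by (auto simp: tb_def td_def)
qed

section \<open>Rips diagrams of a fixed finite metric space\<close>

context
  fixes X :: "'a set" and d :: "'a \<Rightarrow> 'a \<Rightarrow> real"
  assumes metric: "Metric_space X d" and fin: "finite X"
begin

lemma symp_dist_le: "symp (\<lambda>x y. d x y \<le> r)"
  using Metric_space.commute[OF metric] by (auto intro: sympI)

lemma non_neighbours_dist_le:
  "0 \<le> r \<Longrightarrow> x \<in> X \<Longrightarrow> non_neighbours X (\<lambda>x y. d x y \<le> r) x = {y\<in>X. r < d x y}"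
  using Metric_space.mdist_zero[OF metric] by (auto simp: not_le)

lemma dgm_VR_empty:
  assumes "\<And>r. 0 \<le> r \<Longrightarrow> acyclic_at TYPE('f::field) (clique_complex X (\<lambda>x y. d x y \<le> r)) (k + 1)"
  shows "dgm_VR TYPE('f) k X d = {#}"
  unfolding dgm_VR_def
proof (rule persistence_diagram_empty)
  fix r :: real
  assume "0 \<le> r"
  then show "\<exists>w. vcarrier (pspace (VR_persistence X d k
      :: ('f, ('a list \<Rightarrow> 'f) set) persistence_module) r) = {w}"
    using reduced_homology_acyclic[OF assms] VR_eq_clique_complex[OF metric fin]
    by (simp add: VR_persistence_def)
qed

lemma acyclic_at_outside:
  assumes "card X = 2 * p" "0 < p" "0 \<le> r" "\<not> (tb X d \<le> r \<and> r < td X d)"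
  shows "acyclic_at TYPE('f::field) (clique_complex X (\<lambda>x y. d x y \<le> r)) p"
proof -
  obtain x where "x \<in> X" "card {y\<in>X. r < d x y} \<noteq> 1"
    using assms fin tb_le_iff_less_td[of X r d] by auto
  then show ?thesis
    using assms fin by (intro acyclic_at_not_cross_polytope[OF symp_dist_le, of _ _ x])
      (simp_all add: non_neighbours_dist_le)
qed

lemma dgm_VR_single:
  assumes card: "card X = 2 * (k + 1)" and less: "tb X d < td X d"
  shows "dgm_VR TYPE('f::field) k X d = {#(tb X d, td X d)#}"
proof -
  let ?E = "\<lambda>r x y. d x y \<le> r"
  let ?K = "\<lambda>r. clique_complex X (?E r)"
  have two: "card X \<ge> 2" using card by simp
  \<comment> \<open>The interval has to begin within the parameters \<open>r \<ge> 0\<close>, where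
    Rips complexes are clique complexes.\<close>
  have "0 \<le> tb X d"
  proof -
    obtain x where x: "x \<in> X" using two by (cases "X = {}") auto
    then have "0 \<le> tb_pt X d x" by (simp add: tb_pt_def Metric_space.nonneg[OF metric])
    also have "\<dots> \<le> tb X d" unfolding tb_def using x fin by (intro Max_ge) auto
    finally show ?thesis .
  qed
  have cross: "card (non_neighbours X (?E r) x) = 1"
    if "tb X d \<le> r" "r < td X d" "x \<in> X" for r x
    using that tb_le_iff_less_td[OF fin two, of r d] \<open>0 \<le> tb X d\<close>
    by (simp add: non_neighbours_dist_le)
  obtain z :: "'a list \<Rightarrow> 'f" where z: "z \<noteq> (\<lambda>_. 0)"
    "cycles (?K (tb X d)) (k + 1) = range (\<lambda>a l. a * z l)"
    using cross_polytope_cycles[OF symp_dist_le fin card, of "tb X d"] cross[of "tb X d"] less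
    by auto
  \<comment> \<open>Non-neighbours only disappear as \<open>r\<close> grows, and each point has
    exactly one at both scales. So the graph stays the same and one \<open>z\<close> serves the
    whole interval.\<close>
  have const: "?K r = ?K (tb X d)" if r: "tb X d \<le> r" "r < td X d" for r
  proof -
    have "d x y \<le> r \<longleftrightarrow> d x y \<le> tb X d" if xy: "x \<in> X" "y \<in> X" "x \<noteq> y" for x y
    proof -
      have "non_neighbours X (?E r) x \<subseteq> non_neighbours X (?E (tb X d)) x" using r by auto
      then have "non_neighbours X (?E r) x = non_neighbours X (?E (tb X d)) x"
        using cross[OF r xy(1)] cross[OF _ less xy(1)] fin
        by (intro card_subset_eq) auto
      then show ?thesis using xy by blast
    qed
    then show ?thesis by (auto simp: clique_complex_def subset_iff)
  qed
  have "persistence_iso (interval_sum [(tb X d, td X d)])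
      \<lparr>pspace = (\<lambda>r. reduced_homology (?K r) k :: ('f, ('a list \<Rightarrow> 'f) set) vspace),
       pmap = (\<lambda>r s. inclusion_map (?K s) k)\<rparr>"
  proof (rule filtration_single_interval[OF _ _ z(1)])
    show "?K r \<subseteq> ?K s" if "r \<le> s" for r s
      using that by (fastforce simp: clique_complex_def)
    show "cycles (?K r) (k + 1) = range (\<lambda>a l. a * z l)" if "tb X d \<le> r" "r < td X d" for r
      using const[OF that] z(2) by simp
    show "boundaries (?K r) (k + 1) = {\<lambda>_. 0 :: 'f}" if "tb X d \<le> r" "r < td X d" for r
    proof -
      have "chain_space (?K r) (Suc (k + 1)) = {\<lambda>_. 0 :: 'f}"
        by (rule cross_polytope_chain_space[OF symp_dist_le fin _ cross[OF that]])
          (simp add: card)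
      then show ?thesis unfolding boundaries_def boundary_def by simp
    qed
    show "acyclic_at TYPE('f) (?K r) (k + 1)" if "0 \<le> r" "\<not> (tb X d \<le> r \<and> r < td X d)" for r
      using acyclic_at_outside[OF card _ that] by simp
  qed (simp add: fin)
  \<comment> \<open>\<open>persistence_iso\<close> inspects parameters \<open>r \<ge> 0\<close>
    only, and there the two filtrations agree.\<close>
  then have "persistence_iso (interval_sum [(tb X d, td X d)])
      (VR_persistence X d k :: ('f, ('a list \<Rightarrow> 'f) set) persistence_module)"
    using \<open>0 \<le> tb X d\<close> VR_eq_clique_complex[OF metric fin]
    by (simp add: persistence_iso_def VR_persistence_def)
  then show ?thesis
    unfolding dgm_VR_def using \<open>0 \<le> tb X d\<close> less by (rule persistence_diagram_single)
qed

end

theorem theorem4p4: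
  fixes X :: "'a set" and d :: "'a \<Rightarrow> 'a \<Rightarrow> real" and n :: nat
  assumes "Metric_space X d" and "finite X" and "card X = n"
  shows "(\<forall>k::nat. real k > real n / 2 - 1 \<longrightarrow> dgm_VR TYPE('f::field) k X d = {#}) \<and>
         (\<forall>k::nat. even n \<and> real k = real n / 2 - 1 \<longrightarrow>
           (dgm_VR TYPE('f) k X d = {#(tb X d, td X d)#} \<longleftrightarrow> tb X d < td X d) \<and>
           (\<not> tb X d < td X d \<longrightarrow> dgm_VR TYPE('f) k X d = {#}))"
proof (rule conjI; intro allI impI)
  fix k :: nat
  assume "real k > real n / 2 - 1"
  \<comment> \<open>Degree \<open>k\<close> means \<open>k + 1\<close> vertices per simplex, so the
    vanishing results apply with \<open>p = k + 1\<close>.\<close>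
  then have "real n < real (2 * (k + 1))" by simp
  then have "card X < 2 * (k + 1)" using assms(3) by linarith
  then show "dgm_VR TYPE('f) k X d = {#}"
    using assms by (intro dgm_VR_empty acyclic_at_few_vertices symp_dist_le)
next
  fix k :: nat
  assume "even n \<and> real k = real n / 2 - 1"
  then have "real n = real (2 * (k + 1))" by simp
  then have card: "card X = 2 * (k + 1)" using assms(3) by linarith
  \<comment> \<open>The range from \<open>tb X d\<close> to \<open>td X d\<close> is empty, so the
    complex is acyclic at every scale.\<close>
  have "dgm_VR TYPE('f) k X d = {#}" if "\<not> tb X d < td X d"
    using that by (intro dgm_VR_empty acyclic_at_outside assms card) auto
  \<comment> \<open>A one-point diagram forces the strict inequality, since otherwise the diagram is
    empty.\<close>
  then show "(dgm_VR TYPE('f) k X d = {#(tb X d, td X d)#} \<longleftrightarrow> tb X d < td X d) \<and>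
      (\<not> tb X d < td X d \<longrightarrow> dgm_VR TYPE('f) k X d = {#})"
    using dgm_VR_single[OF assms(1,2) card] by (cases "tb X d < td X d") auto
qed

end
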